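(* Consider the sequence of sparse one-sided Gaussian location models $(\mathbf P^{(m)}_{b,c,\beta},m\ge1)$ with fixed parameters $b>0$, $c\in(0,1)$ and a sparsity parameter $\beta\in[0,1)$, and let $\delta\in(0,1)$. For $\alpha\in(0,1)$, let $\hat k_\alpha$ be the number of rejections of the Benjamini–Hochberg (BH) procedure at level $\alpha$, $\kappa=\pi^2/6$, and $$\overline{\mathrm{FDP}}^{\mathrm{DKW}}_\alpha=\mathbf 1\{\hat k_\alpha\ge1\}\wedge\left(\alpha+\frac{m^{1/2}\sqrt{0.5\log(1/\delta)}}{1\vee\hat k_\alpha}\right),$$ $$\overline{\mathrm{FDP}}^{\mathrm{Well}}_\alpha=\mathbf 1\{\hat k_\alpha\ge1\}\wedge\left(\alpha\,h^{-1}\!\left(\frac{2\log(\kappa/\delta)+4\log\Bigl(1+\log_2\bigl(\tfrac{m}{\alpha(1\vee\hat k_\alpha)}\bigr)\Bigr)}{\alpha(1\vee\hat k_\alpha)}\right)\right).$$ Then for all $\alpha\in(0,1)$, $$\overline{\mathrm{FDP}}^{\mathrm{DKW}}_\alpha-\alpha\asymp_{\mathbf P^{(m)}_{b,c,\beta}}m^{-1/2+\beta},$$ $$\overline{\mathrm{FDP}}^{\mathrm{Well}}_\alpha-\alpha\asymp_{\mathbf P^{(m)}_{b,c,\beta}}\sqrt{\log\log(m)}\;m^{-1/2+\beta/2}.$$ In particular, concerning BH $m$-consistency for the model sequence $(\mathbf P^{(m)}_{b,c,\beta},m\ge1)$: - the DKW bound is $m$-consistent when $\beta<1/2$ but fails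 to be for $\beta\ge1/2$; - the Wellner bound is $m$-consistent for any arbitrary $\beta\in(0,1)$.
   Context: Model $\mathbf P^{(m)}_{b,c,\beta}$: $p_i=\overline\Phi(X_i)$, $1\le i\le m$, where $\overline\Phi(z)=\mathbf P(Z\ge z)$ for $Z\sim\mathcal N(0,1)$; the $X_i$ are independent, $X_i\sim\mathcal N(0,1)$ for $i\in\mathcal H_0$ and $X_i\sim\mathcal N(\mu_m,1)$ for $i\in\mathcal H_1=\{1,\dots,m\}\setminus\mathcal H_0$, with $\mu_m=\sqrt{2\beta\log m}+b$ and $|\mathcal H_1|=\lfloor cm^{1-\beta}\rfloor$. With ordered $p$-values $p_{(1)}\le\dots\le p_{(m)}$, $\hat k_\alpha=\max\{k: mp_{(k)}/k\le\alpha\}$ ($=0$ if there is no such $k\in\{1,\dots,m\}$). $h(\lambda)=\lambda(\log\lambda-1)+1$, $\lambda>1$, is an increasing bijection $(1,\infty)\to(0,\infty)$ with inverse $h^{-1}$. $u_m\asymp_P v_m$ stands for $u_m=O_P(v_m)$ and $v_m=O_P(u_m)$, as $m\to\infty$. A bound $\overline{\mathrm{FDP}}_\alpha$ is BH $m$-consistent if for all $\epsilon>0$, $\lim_{m\to\infty}\mathbf P^{(m)}_{b,c,\beta}(\overline{\mathrm{FDP}}_\alpha-\alpha\ge\epsilon)=0$.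
   Formalization: Two rates, false as printed, are corrected: for β>1/2 the DKW bound (at most 1) minus α has exact order 1, and only its term before the minimum with the indicator has order m^{-1/2+β}; for β=0 the Wellner bound minus α has order m^{-1/2}, without √(log log m). *)

theory Defs
  imports "HOL-Probability.Probability"
begin

definition Phi_bar :: "real \<Rightarrow> real" where
  "Phi_bar z = measure (density lborel std_normal_density) {z..}"

text \<open>The model holds for arbitrary probability spaces \<open>M m\<close> and arbitrary positions of the nulls;
  the indices run over \<open>{1..m}\<close>. Nothing is required for \<open>m = 0\<close>.\<close>

definition sparse_gaussian_model ::
  "real \<Rightarrow> real \<Rightarrow> real \<Rightarrow> nat \<Rightarrow> 'a measure \<Rightarrow> (nat \<Rightarrow> 'a \<Rightarrow> real) \<Rightarrow> nat set \<Rightarrow> bool" where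
  "sparse_gaussian_model b c \<beta> m M X H0 \<longleftrightarrow>
     prob_space M \<and>
     H0 \<subseteq> {1..m} \<and>
     int (card ({1..m} - H0)) = \<lfloor>c * real m powr (1 - \<beta>)\<rfloor> \<and>
     prob_space.indep_vars M (\<lambda>_. borel) X {1..m} \<and>
     (\<forall>i\<in>H0. distributed M lborel (X i) (normal_density 0 1)) \<and>
     (\<forall>i\<in>{1..m} - H0.
        distributed M lborel (X i) (normal_density (sqrt (2 * \<beta> * ln (real m)) + b) 1))"

definition order_stat :: "nat \<Rightarrow> (nat \<Rightarrow> real) \<Rightarrow> nat \<Rightarrow> real" where
  "order_stat m p k = sort (map p [1..<Suc m]) ! (k - 1)"

definition BH_rejections :: "nat \<Rightarrow> (nat \<Rightarrow> real) \<Rightarrow> real \<Rightarrow> nat" where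
  "BH_rejections m p \<alpha> =
     Max (insert 0 {k \<in> {1..m}. real m * order_stat m p k / real k \<le> \<alpha>})"

definition h :: "real \<Rightarrow> real" where
  "h x = x * (ln x - 1) + 1"

definition h_inv :: "real \<Rightarrow> real" where
  "h_inv = the_inv_into {1<..} h"

definition DKW_uncapped :: "real \<Rightarrow> real \<Rightarrow> nat \<Rightarrow> nat \<Rightarrow> real" where
  "DKW_uncapped \<delta> \<alpha> m k =
     \<alpha> + sqrt (real m) * sqrt (0.5 * ln (1 / \<delta>)) / max 1 (real k)"

definition FDP_DKW :: "real \<Rightarrow> real \<Rightarrow> nat \<Rightarrow> nat \<Rightarrow> real" where
  "FDP_DKW \<delta> \<alpha> m k = min (of_bool (k \<ge> 1)) (DKW_uncapped \<delta> \<alpha> m k)"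

definition FDP_Well :: "real \<Rightarrow> real \<Rightarrow> nat \<Rightarrow> nat \<Rightarrow> real" where
  "FDP_Well \<delta> \<alpha> m k =
     min (of_bool (k \<ge> 1))
       (\<alpha> * h_inv ((2 * ln ((pi\<^sup>2 / 6) / \<delta>)
                     + 4 * ln (1 + log 2 (real m / (\<alpha> * max 1 (real k)))))
                   / (\<alpha> * max 1 (real k))))"

definition bigO_P :: "(nat \<Rightarrow> 'a measure) \<Rightarrow> (nat \<Rightarrow> 'a \<Rightarrow> real) \<Rightarrow> (nat \<Rightarrow> 'a \<Rightarrow> real) \<Rightarrow> bool" where
  "bigO_P M u v \<longleftrightarrow>
     (\<forall>\<epsilon>>0. \<exists>K>0. \<forall>\<^sub>F m in sequentially.
        measure (M m) {\<omega> \<in> space (M m). \<bar>u m \<omega>\<bar> \<le> K * \<bar>v m \<omega>\<bar>} \<ge> 1 - \<epsilon>)"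

definition asymp_P :: "(nat \<Rightarrow> 'a measure) \<Rightarrow> (nat \<Rightarrow> 'a \<Rightarrow> real) \<Rightarrow> (nat \<Rightarrow> 'a \<Rightarrow> real) \<Rightarrow> bool" where
  "asymp_P M u v \<longleftrightarrow> bigO_P M u v \<and> bigO_P M v u"

definition BH_m_consistent :: "(nat \<Rightarrow> 'a measure) \<Rightarrow> real \<Rightarrow> (nat \<Rightarrow> 'a \<Rightarrow> real) \<Rightarrow> bool" where
  "BH_m_consistent M \<alpha> F \<longleftrightarrow>
     (\<forall>\<epsilon>>0. (\<lambda>m. measure (M m) {\<omega> \<in> space (M m). F m \<omega> - \<alpha> \<ge> \<epsilon>}) \<longlonglongrightarrow> 0)"

end

theory Submission
  imports Defs "HOL-Real_Asymp.Real_Asymp"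
begin

text \<open>
  Everything follows from the fact that the number of rejections is of exact order
  \<open>m powr (1 - \<beta>)\<close> with probability tending to 1.

  Lower bound: \<open>Phi_bar (C + \<mu>) \<le> exp (- \<mu> C - \<mu>\<^sup>2 / 2) Phi_bar C \<le> m powr (- \<beta>) exp (- b C) Phi_bar C\<close>,
  while a fraction of about \<open>Phi_bar C\<close> of the alternatives exceeds \<open>\<mu> + C\<close>. For \<open>C\<close> large this is
  enough for BH to reject that fraction. Upper bound: if BH rejects \<open>k\<close> hypotheses, then at least
  \<open>k - |H1|\<close> null \<open>p\<close>-values lie below \<open>\<alpha> k / m\<close>, which is exponentially unlikely in \<open>k\<close> once \<open>k\<close> is a
  large multiple of \<open>|H1|\<close>.

  On this event both bounds are deterministic functions of the number of rejections; for the Wellner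
  bound, \<open>1 + sqrt x \<le> h_inv x \<le> 1 + 2 sqrt x\<close> for small \<open>x\<close>.
\<close>

section \<open>Gaussian tails\<close>

lemma prob_space_std_normal: "prob_space std_normal_distribution"
  by (rule prob_space_normal_density) simp

lemma Phi_bar_antimono: "x \<le> y \<Longrightarrow> Phi_bar y \<le> Phi_bar x"
proof -
  interpret N: prob_space std_normal_distribution by (rule prob_space_std_normal)
  show "x \<le> y \<Longrightarrow> Phi_bar y \<le> Phi_bar x"
    unfolding Phi_bar_def by (intro N.finite_measure_mono) auto
qed

lemma emeasure_std_normal_atLeast:
  "emeasure std_normal_distribution {z..} = ennreal (Phi_bar z)"
proof -
  interpret N: prob_space std_normal_distribution by (rule prob_space_std_normal)
  show ?thesis
    unfolding Phi_bar_def by (rule N.emeasure_eq_measure)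
qed

lemma Phi_bar_nonneg: "0 \<le> Phi_bar z"
  by (simp add: Phi_bar_def)

lemma Phi_bar_le_1: "Phi_bar z \<le> 1"
  using prob_space.prob_le_1[OF prob_space_std_normal] by (simp add: Phi_bar_def)

text \<open>The density is strictly positive, so a Gaussian null set is a Lebesgue null set, whereas
  \<open>{z..}\<close> contains an interval of length one.\<close>

lemma Phi_bar_pos: "0 < Phi_bar z"
proof (rule ccontr)
  assume "\<not> 0 < Phi_bar z"
  then have "emeasure std_normal_distribution {z..} = 0"
    using emeasure_std_normal_atLeast[of z] by (simp add: ennreal_neg)
  then have "{z..} \<in> null_sets std_normal_distribution"
    by (simp add: null_setsI)
  then have "AE x in lborel. x \<in> {z..} \<longrightarrow> ennreal (std_normal_density x) = 0"
    by (subst (asm) null_sets_density_iff) auto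
  then have "AE x in lborel. x \<notin> {z..}"
  proof (rule AE_mp, intro AE_I2 impI)
    fix x assume "x \<in> {z..} \<longrightarrow> ennreal (std_normal_density x) = 0"
    moreover have "std_normal_density x > 0"
      by (rule normal_density_pos) simp
    ultimately show "x \<notin> {z..}"
      by (auto simp: ennreal_eq_0_iff)
  qed
  then have "{z..} \<in> null_sets lborel"
    by (subst AE_iff_null_sets) auto
  then have "{z..z+1} \<in> null_sets lborel"
    by (rule null_sets_subset) auto
  then show False
    by (auto dest: null_setsD1)
qed

lemma Phi_bar_measurable [measurable]: "Phi_bar \<in> borel_measurable borel"
proof -
  have "mono (\<lambda>x. - Phi_bar x)"
    by (intro monoI) (simp add: Phi_bar_antimono)
  then have "(\<lambda>x. - Phi_bar x) \<in> borel_measurable borel"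
    by (rule borel_measurable_mono)
  then show ?thesis
    by simp
qed

text \<open>Translating the integration variable by \<open>d\<close> multiplies the density by
  \<open>exp (- d * y - d^2 / 2)\<close>, which is largest at \<open>y = C\<close>. The extra factor
  \<open>exp (- d * C)\<close> is what later pushes the p-values of large alternatives below the BH
  line.\<close>

lemma Phi_bar_add_le:
  assumes "0 \<le> C" "0 \<le> d"
  shows "Phi_bar (C + d) \<le> exp (- d * C - d\<^sup>2 / 2) * Phi_bar C"
proof -
  let ?e = "exp (- d * C - d\<^sup>2 / 2)"
  have pt: "std_normal_density (d + y) * indicator {C + d..} (d + y)
             \<le> ?e * (std_normal_density y * indicator {C..} y)" for y
  proof (cases "C \<le> y")
    case True
    have "std_normal_density (d + y) = exp (- d * y - d\<^sup>2 / 2) * std_normal_density y"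
      by (simp add: normal_density_def exp_add[symmetric] exp_diff[symmetric] field_simps power2_eq_square)
    also have "\<dots> \<le> ?e * std_normal_density y"
      using True assms by (intro mult_right_mono) (auto simp: mult_left_mono normal_density_nonneg)
    finally show ?thesis
      using True by simp
  qed (auto simp: indicator_def)
  have "ennreal (Phi_bar (C + d)) =
      (\<integral>\<^sup>+ x. ennreal (std_normal_density x * indicator {C + d..} x) \<partial>lborel)"
    by (subst emeasure_std_normal_atLeast[symmetric], subst emeasure_density)
       (auto intro!: nn_integral_cong simp: ennreal_mult' indicator_def)
  also have "\<dots> = (\<integral>\<^sup>+ y. ennreal (std_normal_density (d + y) * indicator {C + d..} (d + y)) \<partial>lborel)"
    by (subst nn_integral_real_affine[where c = 1 and t = d]) (simp_all)
  also have "\<dots> \<le> (\<integral>\<^sup>+ y. ennreal ?e * ennreal (std_normal_density y * indicator {C..} y) \<partial>lborel)"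
    by (intro nn_integral_mono, subst ennreal_mult'[symmetric]) (auto intro!: ennreal_leI pt[simplified])
  also have "\<dots> = ennreal ?e * (\<integral>\<^sup>+ y. ennreal (std_normal_density y * indicator {C..} y) \<partial>lborel)"
    by (rule nn_integral_cmult) auto
  also have "(\<integral>\<^sup>+ y. ennreal (std_normal_density y * indicator {C..} y) \<partial>lborel) = ennreal (Phi_bar C)"
    by (subst emeasure_std_normal_atLeast[symmetric], subst emeasure_density)
       (auto intro!: nn_integral_cong simp: ennreal_mult' indicator_def)
  finally have "ennreal (Phi_bar (C + d)) \<le> ennreal (?e * Phi_bar C)"
    by (simp add: ennreal_mult')
  then show ?thesis
    by (simp add: Phi_bar_nonneg)
qed

lemma std_normal_p_value_superuniform:
  assumes "0 \<le> t"
  shows "measure std_normal_distribution {x. Phi_bar x \<le> t} \<le> t"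
proof -
  interpret N: prob_space std_normal_distribution by (rule prob_space_std_normal)
  let ?N = std_normal_distribution and ?S = "{x. Phi_bar x \<le> t}"
  \<comment> \<open>A compact subset of the up-closed set has a least element; inner regularity replaces the
    continuity of \<open>Phi_bar\<close>.\<close>
  have "emeasure ?N ?S = (SUP K \<in> {K. K \<subseteq> ?S \<and> compact K}. emeasure ?N K)"
    by (rule inner_regular) (auto simp: N.emeasure_eq_measure)
  also have "\<dots> \<le> ennreal t"
  proof (rule SUP_least)
    fix K assume K: "K \<in> {K. K \<subseteq> ?S \<and> compact K}"
    show "emeasure ?N K \<le> ennreal t"
    proof (cases "K = {}")
      case False
      then obtain z where z: "z \<in> K" "\<And>y. y \<in> K \<Longrightarrow> z \<le> y"
        using compact_attains_inf[of K] K by blast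
      then have "emeasure ?N K \<le> emeasure ?N {z..}"
        by (intro emeasure_mono) auto
      also have "\<dots> \<le> ennreal t"
        using z K by (auto simp: emeasure_std_normal_atLeast intro!: ennreal_leI)
      finally show ?thesis .
    qed simp
  qed
  finally show ?thesis
    using assms by (simp add: N.emeasure_eq_measure)
qed

section \<open>Counting form of the Benjamini--Hochberg procedure\<close>

text \<open>In a sorted list the positions of the entries \<open>\<le> t\<close> form an initial
  segment, so a position belongs to it exactly when it is below its length.\<close>

lemma sorted_nth_le_iff:
  fixes t :: "'a :: linorder"
  assumes "sorted xs" "k < length xs"
  shows "xs ! k \<le> t \<longleftrightarrow> k < length (filter (\<lambda>x. x \<le> t) xs)"
proof -
  let ?J = "{j. j < length xs \<and> xs ! j \<le> t}"
  have card: "length (filter (\<lambda>x. x \<le> t) xs) = card ?J"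
    by (rule length_filter_conv_card)
  show ?thesis
  proof
    assume "xs ! k \<le> t"
    then have "{..k} \<subseteq> ?J"
      using assms by (auto intro: order.trans[OF sorted_nth_mono])
    then have "card {..k} \<le> card ?J"
      by (intro card_mono) auto
    then show "k < length (filter (\<lambda>x. x \<le> t) xs)"
      using card by simp
  next
    assume less: "k < length (filter (\<lambda>x. x \<le> t) xs)"
    show "xs ! k \<le> t"
    proof (rule ccontr)
      assume "\<not> xs ! k \<le> t"
      then have "?J \<subseteq> {..<k}"
        using assms by (auto simp: not_le[symmetric] intro: order.trans[OF sorted_nth_mono])
      then have "card ?J \<le> card {..<k}"
        by (intro card_mono) auto
      then show False
        using less card by simp
    qed
  qed
qed

text \<open>This removes sorting from the analysis of BH. The zero-based position
  \<open>k - 1\<close> turns the strict inequality on positions into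
  \<open>k \<le> card ...\<close>; \<open>k \<ge> 1\<close> makes the subtraction exact.\<close>

lemma order_stat_le_iff:
  assumes "k \<in> {1..m}"
  shows "order_stat m p k \<le> t \<longleftrightarrow> k \<le> card {i\<in>{1..m}. p i \<le> t}"
proof -
  have "length (filter (\<lambda>x. x \<le> t) (sort (map p [1..<Suc m]))) =
      length (filter (\<lambda>i. p i \<le> t) [1..<Suc m])"
    by (simp add: filter_sort filter_map comp_def del: upt_Suc)
  also have "\<dots> = card (set (filter (\<lambda>i. p i \<le> t) [1..<Suc m]))"
    by (subst distinct_card) (auto simp del: upt_Suc)
  also have "set (filter (\<lambda>i. p i \<le> t) [1..<Suc m]) = {i\<in>{1..m}. p i \<le> t}"
    by auto
  finally show ?thesis
    unfolding order_stat_def using assms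
    by (subst sorted_nth_le_iff) auto
qed

lemma BH_rejections_eq:
  "BH_rejections m p \<alpha> =
     Max (insert 0 {k\<in>{1..m}. k \<le> card {i\<in>{1..m}. p i \<le> \<alpha> * real k / real m}})"
proof -
  have "real m * order_stat m p k / real k \<le> \<alpha> \<longleftrightarrow>
      k \<le> card {i\<in>{1..m}. p i \<le> \<alpha> * real k / real m}" if "k \<in> {1..m}" for k
    by (subst order_stat_le_iff[OF that, symmetric]) (use that in \<open>simp add: field_simps\<close>)
  then show ?thesis
    unfolding BH_rejections_def by (intro arg_cong[where f = Max] arg_cong[where f = "insert 0"]) blast
qed

lemma BH_rejections_le: "BH_rejections m p \<alpha> \<le> m"
  unfolding BH_rejections_eq by (subst Max_le_iff) auto

lemma BH_rejections_ge:
  assumes "k \<in> {1..m}" "k \<le> card {i\<in>{1..m}. p i \<le> \<alpha> * real k / real m}"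
  shows "k \<le> BH_rejections m p \<alpha>"
  unfolding BH_rejections_eq using assms by (intro Max_ge) auto

text \<open>The maximum is attained, and for the inserted 0 the inequality is trivial. This feeds
  the upper tail; maximality, in \<open>BH_rejections_ge\<close>, feeds the lower tail.\<close>

lemma BH_rejections_self_consistent:
  "BH_rejections m p \<alpha> \<le> card {i\<in>{1..m}. p i \<le> \<alpha> * real (BH_rejections m p \<alpha>) / real m}"
proof -
  have "BH_rejections m p \<alpha> \<in>
      insert 0 {k\<in>{1..m}. k \<le> card {i\<in>{1..m}. p i \<le> \<alpha> * real k / real m}}"
    by (subst BH_rejections_eq, rule Max_in) auto
  then show ?thesis
    by auto
qed

lemma count_measurable:
  fixes X :: "nat \<Rightarrow> 'a \<Rightarrow> real"
  assumes X: "\<And>i. i \<in> I \<Longrightarrow> X i \<in> borel_measurable M" and [measurable]: "A \<in> sets borel"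
  shows "(\<lambda>\<omega>. card {i\<in>I. X i \<omega> \<in> A}) \<in> measurable M (count_space UNIV)"
proof (rule measurable_card)
  show "{\<omega>\<in>space M. i \<in> {i\<in>I. X i \<omega> \<in> A}} \<in> sets M" for i
  proof (cases "i \<in> I")
    case True
    note [measurable] = X[OF True]
    show ?thesis
      using True by simp
  qed simp
qed

lemma BH_rejections_measurable:
  assumes [measurable]: "\<And>i. i \<in> {1..m} \<Longrightarrow> p i \<in> borel_measurable M"
  shows "(\<lambda>\<omega>. BH_rejections m (\<lambda>i. p i \<omega>) \<alpha>) \<in> measurable M (count_space UNIV)"
proof -
  \<comment> \<open>The form \<open>{k. P k}\<close> is the one in which measurability of
    \<open>Max\<close> over random sets of naturals applies.\<close>
  have *: "insert 0 {k\<in>{1..m}. k \<le> card {i\<in>{1..m}. p i \<omega> \<le> \<alpha> * real k / real m}} =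
      {k. k = 0 \<or> k \<in> {1..m} \<and> k \<le> card {i\<in>{1..m}. p i \<omega> \<le> \<alpha> * real k / real m}}" for \<omega>
    by auto
  have [measurable]: "(\<lambda>\<omega>. card {i\<in>{1..m}. p i \<omega> \<le> \<alpha> * real k / real m}) \<in> measurable M (count_space UNIV)" for k
    using count_measurable[of "{1..m}" p M "{..\<alpha> * real k / real m}"] by simp
  show ?thesis
    unfolding BH_rejections_eq * by measurable
qed

section \<open>Chernoff bounds for counts\<close>

context prob_space
begin

text \<open>The exponential of the count is a product of independent factors
  \<open>1 + (exp \<theta> - 1) * indicator\<close>, and \<open>1 + x \<le> exp x\<close> bounds
  each expectation. The bound is the Poisson moment generating function with the same mean, for
  unequal probabilities and either sign of \<open>\<theta>\<close>.\<close>

lemma expectation_exp_count_le: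
  fixes X :: "'i \<Rightarrow> 'a \<Rightarrow> real"
  assumes indep: "indep_vars (\<lambda>_. borel) X I" and fin: "finite I" and [measurable]: "A \<in> sets borel"
  shows "integrable M (\<lambda>\<omega>. exp (\<theta> * real (card {i\<in>I. X i \<omega> \<in> A})))" (is ?int)
    and "expectation (\<lambda>\<omega>. exp (\<theta> * real (card {i\<in>I. X i \<omega> \<in> A})))
      \<le> exp ((exp \<theta> - 1) * (\<Sum>i\<in>I. prob {\<omega>\<in>space M. X i \<omega> \<in> A}))" (is ?le)
proof -
  let ?Y = "\<lambda>i \<omega>. exp (\<theta> * indicator A (X i \<omega>)) :: real"
  have rv [measurable]: "X i \<in> borel_measurable M" if "i \<in> I" for i
    using indep that by (auto simp: indep_vars_def2)
  have eq: "exp (\<theta> * real (card {i\<in>I. X i \<omega> \<in> A})) = (\<Prod>i\<in>I. ?Y i \<omega>)" for \<omega>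
  proof -
    have "real (card {i\<in>I. X i \<omega> \<in> A}) = (\<Sum>i\<in>I. indicator A (X i \<omega>))"
      using fin by (simp add: indicator_def sum.If_cases Int_def)
    then show ?thesis
      by (simp only: sum_distrib_left exp_sum[OF fin])
  qed
  have indepY: "indep_vars (\<lambda>_. borel) ?Y I"
    by (rule indep_vars_compose2[OF indep]) measurable
  have Y_eq: "?Y i \<omega> = 1 + (exp \<theta> - 1) * indicator {\<omega>\<in>space M. X i \<omega> \<in> A} \<omega>" if "\<omega> \<in> space M" for i \<omega>
    using that by (simp add: indicator_def)
  have intY: "integrable M (?Y i)" if "i \<in> I" for i
  proof (rule integrable_const_bound[where B = "max 1 (exp \<theta>)"])
    show "?Y i \<in> borel_measurable M"
      using rv[OF that] by measurable
  qed (auto simp: indicator_def)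
  have EY: "expectation (?Y i) = 1 + (exp \<theta> - 1) * prob {\<omega>\<in>space M. X i \<omega> \<in> A}" if "i \<in> I" for i
  proof -
    have [measurable]: "{\<omega>\<in>space M. X i \<omega> \<in> A} \<in> events"
      using rv[OF that] by measurable
    have "expectation (?Y i) = expectation (\<lambda>\<omega>. 1 + (exp \<theta> - 1) * indicator {\<omega>\<in>space M. X i \<omega> \<in> A} \<omega>)"
      by (intro Bochner_Integration.integral_cong refl Y_eq)
    also have "\<dots> = 1 + (exp \<theta> - 1) * prob {\<omega>\<in>space M. X i \<omega> \<in> A}"
      by (subst Bochner_Integration.integral_add) (auto simp: prob_space less_top[symmetric] intro!: integrable_real_indicator)
    finally show ?thesis .
  qed
  show ?int
    unfolding eq by (rule indep_vars_integrable[OF fin indepY intY])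
  have "expectation (\<lambda>\<omega>. \<Prod>i\<in>I. ?Y i \<omega>) = (\<Prod>i\<in>I. expectation (?Y i))"
    by (rule indep_vars_lebesgue_integral[OF fin indepY intY])
  also have "\<dots> \<le> (\<Prod>i\<in>I. exp ((exp \<theta> - 1) * prob {\<omega>\<in>space M. X i \<omega> \<in> A}))"
  proof (rule prod_mono, rule conjI)
    fix i assume "i \<in> I"
    show "0 \<le> expectation (?Y i)"
      by (rule Bochner_Integration.integral_nonneg) simp
    show "expectation (?Y i) \<le> exp ((exp \<theta> - 1) * prob {\<omega>\<in>space M. X i \<omega> \<in> A})"
      unfolding EY[OF \<open>i \<in> I\<close>] by (rule exp_ge_add_one_self)
  qed
  also have "\<dots> = exp ((exp \<theta> - 1) * (\<Sum>i\<in>I. prob {\<omega>\<in>space M. X i \<omega> \<in> A}))"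
    using fin by (simp add: exp_sum sum_distrib_left)
  finally show ?le
    unfolding eq .
qed

text \<open>Markov's inequality for the exponential of \<open>\<theta>\<close> times the count.
  Scaling the event by \<open>\<theta>\<close> covers both tails: positive \<open>\<theta>\<close>
  bounds large counts, negative \<open>\<theta>\<close> small ones.\<close>

lemma count_chernoff:
  fixes X :: "'i \<Rightarrow> 'a \<Rightarrow> real"
  assumes "indep_vars (\<lambda>_. borel) X I" "finite I" "A \<in> sets borel"
  shows "prob {\<omega>\<in>space M. \<theta> * real (card {i\<in>I. X i \<omega> \<in> A}) \<ge> s}
    \<le> exp ((exp \<theta> - 1) * (\<Sum>i\<in>I. prob {\<omega>\<in>space M. X i \<omega> \<in> A}) - s)"
proof -
  have "prob {\<omega>\<in>space M. \<theta> * real (card {i\<in>I. X i \<omega> \<in> A}) \<ge> s} =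
      prob {\<omega>\<in>space M. exp (\<theta> * real (card {i\<in>I. X i \<omega> \<in> A})) \<ge> exp s}"
    by simp
  also have "\<dots> \<le> expectation (\<lambda>\<omega>. exp (\<theta> * real (card {i\<in>I. X i \<omega> \<in> A}))) / exp s"
    by (rule integral_Markov_inequality_measure[where A = "{}"])
       (auto intro: expectation_exp_count_le[OF assms])
  also have "\<dots> \<le> exp ((exp \<theta> - 1) * (\<Sum>i\<in>I. prob {\<omega>\<in>space M. X i \<omega> \<in> A})) / exp s"
    by (intro divide_right_mono expectation_exp_count_le[OF assms]) auto
  finally show ?thesis
    by (simp add: exp_diff)
qed

end

section \<open>The inverse of \<open>h\<close>\<close>

lemma h_has_derivative: "x > 0 \<Longrightarrow> (h has_real_derivative ln x) (at x)"
  unfolding h_def by (auto intro!: derivative_eq_intros)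

text \<open>The derivative \<open>ln\<close> is positive to the right of 1 but vanishes at 1, hence
  the criterion that asks for positivity only on the open interval.\<close>

lemma h_strict_mono: "1 \<le> x \<Longrightarrow> x < y \<Longrightarrow> h x < h y"
proof (rule DERIV_pos_imp_increasing_open[of x y h])
  assume "1 \<le> x" "x < y"
  then show "\<exists>D. (h has_real_derivative D) (at z) \<and> 0 < D" if "x < z" "z < y" for z
    using that by (intro exI[of _ "ln z"]) (auto intro: h_has_derivative)
  show "continuous_on {x..y} h"
    using \<open>1 \<le> x\<close> by (intro DERIV_continuous_on[where D = ln])
      (auto intro!: has_field_derivative_at_within h_has_derivative)
qed

text \<open>Here \<open>h (1 + y) = (1 + y) * ln (1 + y) - y\<close>, and
  \<open>ln (1 + y) \<le> y\<close>.\<close>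

lemma h_one_plus_le: "0 \<le> y \<Longrightarrow> h (1 + y) \<le> y\<^sup>2"
proof -
  assume "0 \<le> y"
  then have "(1 + y) * ln (1 + y) \<le> (1 + y) * y"
    by (intro mult_left_mono ln_add_one_self_le_self) auto
  then show ?thesis
    by (simp add: h_def algebra_simps power2_eq_square)
qed

text \<open>Both sides vanish at 0, and their derivatives \<open>z / 2\<close> and
  \<open>ln (1 + z)\<close> are ordered on the unit interval.\<close>

lemma h_one_plus_ge:
  assumes "0 \<le> y" "y \<le> 1"
  shows "y\<^sup>2 / 4 \<le> h (1 + y)"
proof -
  \<comment> \<open>Applying \<open>ln u \<le> u - 1\<close> at \<open>u = 1 / (1 + z)\<close> gives
    \<open>ln (1 + z) \<ge> z / (1 + z)\<close>, and \<open>1 + z \<le> 2\<close>.\<close>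
  have ln_ge: "z / 2 \<le> ln (1 + z)" if "0 \<le> z" "z \<le> 1" for z :: real
  proof -
    have "z / 2 \<le> z / (1 + z)"
      using that by (intro divide_left_mono) auto
    also have "\<dots> = 1 - 1 / (1 + z)"
      using that by (simp add: field_simps)
    also have "\<dots> \<le> ln (1 + z)"
      using ln_le_minus_one[of "1 / (1 + z)"] that by (simp add: ln_div)
    finally show ?thesis .
  qed
  have "(\<lambda>z. h (1 + z) - z\<^sup>2 / 4) 0 \<le> (\<lambda>z. h (1 + z) - z\<^sup>2 / 4) y"
  proof (rule DERIV_nonneg_imp_nondecreasing[OF assms(1)])
    fix z assume z: "0 \<le> z" "z \<le> y"
    have "((\<lambda>z. h (1 + z)) has_real_derivative ln (1 + z) * 1) (at z)"
      by (rule DERIV_chain2[where f = h], rule h_has_derivative)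
         (use z in \<open>auto intro!: derivative_eq_intros\<close>)
    then have "((\<lambda>z. h (1 + z) - z\<^sup>2 / 4) has_real_derivative ln (1 + z) * 1 - z / 2) (at z)"
      by (rule DERIV_diff) (auto intro!: derivative_eq_intros)
    then show "\<exists>D. ((\<lambda>z. h (1 + z) - z\<^sup>2 / 4) has_real_derivative D) (at z) \<and> 0 \<le> D"
      using ln_ge[of z] z assms by (intro exI[of _ "ln (1 + z) * 1 - z / 2"]) auto
  qed
  then show ?thesis
    by (simp add: h_def)
qed

text \<open>\<open>the_inv_into\<close> is meaningful only on the image of an injective function:
  injectivity comes from strict monotonicity, and the intermediate value theorem puts every positive
  number into the image.\<close>

lemma h_inv_exists:
  assumes "x > 0"
  shows "h_inv x > 1" "h (h_inv x) = x"
proof -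
  have inj: "inj_on h {1<..}"
    by (intro linorder_inj_onI') (use h_strict_mono in \<open>fastforce simp: less_le\<close>)
  \<comment> \<open>The right end \<open>exp 2 + x\<close> has logarithm at least 2, so
    \<open>h\<close> there is at least \<open>exp 2 + x\<close> itself, which exceeds
    \<open>x\<close>.\<close>
  have "\<exists>z\<ge>1. z \<le> exp 2 + x \<and> h z = x"
  proof (rule IVT')
    show "h 1 \<le> x"
      using assms by (simp add: h_def)
    have "2 \<le> ln (exp 2 + x)"
      using assms by (subst ln_ge_iff) (auto intro: add_pos_pos)
    then have le: "(exp 2 + x) * 1 \<le> (exp 2 + x) * (ln (exp 2 + x) - 1)"
      using assms by (intro mult_left_mono) auto
    have "x \<le> (exp 2 + x) * 1"
      by simp
    also note le
    also have "(exp 2 + x) * (ln (exp 2 + x) - 1) \<le> h (exp 2 + x)"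
      by (simp add: h_def)
    finally show "x \<le> h (exp 2 + x)" .
    show "1 \<le> exp 2 + x"
      using assms one_le_exp_iff[of "2 :: real"] by linarith
    show "continuous_on {1..exp 2 + x} h"
      by (intro DERIV_continuous_on[where D = ln])
        (auto intro!: has_field_derivative_at_within h_has_derivative)
  qed
  then obtain z where z: "z \<ge> 1" "h z = x" by blast
  with assms have "z > 1"
    by (cases "z = 1") (auto simp: h_def)
  then have "x \<in> h ` {1<..}"
    using z by auto
  then show "h_inv x > 1" "h (h_inv x) = x"
    unfolding h_inv_def using the_inv_into_into[OF inj _ subset_refl, of x] f_the_inv_into_f[OF inj, of x]
    by auto
qed

text \<open>Strict monotonicity transfers \<open>h (1 + sqrt x) \<le> x\<close> to the
  inverse.\<close>

lemma h_inv_ge: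
  assumes "x > 0"
  shows "1 + sqrt x \<le> h_inv x"
proof (rule ccontr)
  assume "\<not> 1 + sqrt x \<le> h_inv x"
  then have "h (h_inv x) < h (1 + sqrt x)"
    using h_inv_exists[OF assms] by (intro h_strict_mono) auto
  also have "\<dots> \<le> x"
    using h_one_plus_le[of "sqrt x"] assms by simp
  finally show False
    using h_inv_exists[OF assms] by simp
qed

text \<open>The quadratic lower bound on \<open>h\<close> is applied at
  \<open>y = 2 * sqrt x\<close>; its range \<open>y \<le> 1\<close> is exactly
  \<open>x \<le> 1 / 4\<close>.\<close>

lemma h_inv_le:
  assumes "0 < x" "x \<le> 1 / 4"
  shows "h_inv x \<le> 1 + 2 * sqrt x"
proof (rule ccontr)
  assume "\<not> h_inv x \<le> 1 + 2 * sqrt x"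
  then have "h (1 + 2 * sqrt x) < h (h_inv x)"
    using assms by (intro h_strict_mono) auto
  moreover have "sqrt x \<le> 1 / 2"
    using assms by (intro real_le_lsqrt) (auto simp: power2_eq_square)
  then have "x \<le> h (1 + 2 * sqrt x)"
    using h_one_plus_ge[of "2 * sqrt x"] assms by (simp add: power_mult_distrib)
  ultimately show False
    using h_inv_exists[OF assms(1)] by simp
qed

section \<open>Tails of the number of rejections\<close>

lemma (in prob_space) prob_std_normal_p_value_le:
  assumes X: "distributed M lborel X std_normal_density" and "0 \<le> t"
  shows "prob {\<omega>\<in>space M. Phi_bar (X \<omega>) \<le> t} \<le> t"
proof -
  have [measurable]: "X \<in> borel_measurable M"
    using distributed_measurable[OF X] by simp
  have "prob {\<omega>\<in>space M. Phi_bar (X \<omega>) \<le> t} = measure (distr M lborel X) {x. Phi_bar x \<le> t}"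
    by (subst measure_distr) (auto intro!: arg_cong[where f = prob])
  also have "distr M lborel X = std_normal_distribution"
    by (rule distributed_distr_eq_density[OF X])
  finally show ?thesis
    using std_normal_p_value_superuniform[OF \<open>0 \<le> t\<close>] by simp
qed

lemma (in prob_space) prob_shifted_normal_ge:
  assumes X: "distributed M lborel X (normal_density \<mu> 1)"
  shows "prob {\<omega>\<in>space M. X \<omega> \<ge> C + \<mu>} = Phi_bar C"
proof -
  have Y: "distributed M lborel (\<lambda>\<omega>. X \<omega> - \<mu>) std_normal_density"
    using normal_standard_normal_convert[of 1 X \<mu>] X by simp
  have [measurable]: "X \<in> borel_measurable M"
    using distributed_measurable[OF X] by simp
  have "prob {\<omega>\<in>space M. X \<omega> \<ge> C + \<mu>} = measure (distr M lborel (\<lambda>\<omega>. X \<omega> - \<mu>)) {C..}"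
    by (subst measure_distr) (auto intro!: arg_cong[where f = prob])
  also have "distr M lborel (\<lambda>\<omega>. X \<omega> - \<mu>) = std_normal_distribution"
    by (rule distributed_distr_eq_density[OF Y])
  finally show ?thesis
    by (simp add: Phi_bar_def)
qed

lemma model_measurable:
  assumes "sparse_gaussian_model b c \<beta> m M X H0" "i \<in> {1..m}"
  shows "X i \<in> borel_measurable M"
proof -
  interpret prob_space M
    using assms by (simp add: sparse_gaussian_model_def)
  show ?thesis
    using assms by (auto simp: sparse_gaussian_model_def indep_vars_def2)
qed

lemma model_khat_measurable:
  assumes "sparse_gaussian_model b c \<beta> m M X H0"
  shows "(\<lambda>\<omega>. BH_rejections m (\<lambda>i. Phi_bar (X i \<omega>)) \<alpha>) \<in> measurable M (count_space UNIV)"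
  by (rule BH_rejections_measurable)
     (intro measurable_compose[OF model_measurable[OF assms] Phi_bar_measurable])

text \<open>With \<open>a = (1 + \<alpha>) / 2\<close>, rejecting \<open>k \<ge> k0\<close>
  hypotheses forces at least \<open>a * k\<close> null p-values below
  \<open>\<alpha> * k / m\<close>, while their expected number is at most
  \<open>\<alpha> * k\<close>. Chernoff bounds this by \<open>exp (- \<gamma> * k)\<close>, with
  \<open>\<gamma>\<close> the Poisson large-deviation rate, and summing over
  \<open>k \<ge> k0\<close> gives a geometric series.\<close>

lemma khat_upper_tail:
  fixes k0 :: nat
  assumes model: "sparse_gaussian_model b c \<beta> m M X H0" and "m \<ge> 1"
    and \<alpha>: "0 < \<alpha>" "\<alpha> < 1"
    and \<gamma>: "\<gamma> = \<alpha> * h (((1 + \<alpha>) / 2) / \<alpha>)"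
    and k0: "2 * real (card ({1..m} - H0)) \<le> (1 - \<alpha>) * real k0"
  shows "measure M {\<omega>\<in>space M. k0 \<le> BH_rejections m (\<lambda>i. Phi_bar (X i \<omega>)) \<alpha>}
    \<le> exp (- \<gamma> * real k0) / (1 - exp (- \<gamma>))"
proof -
  interpret prob_space M
    using model by (simp add: sparse_gaussian_model_def)
  \<comment> \<open>The hypothesis on \<open>k0\<close> bounds the number of alternatives by
    \<open>(1 - \<alpha>) / 2 * k\<close>, so at least the share
    \<open>1 - (1 - \<alpha>) / 2 = a\<close> of the rejections is null.\<close>
  define a where "a = (1 + \<alpha>) / 2"
  have a: "\<alpha> < a" "a < 1"
    using \<alpha> by (auto simp: a_def)
  have \<gamma>_eq: "\<gamma> = ln (a / \<alpha>) * a - (a - \<alpha>)"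
    using \<alpha> unfolding \<gamma> a_def[symmetric] h_def by (simp add: field_simps)
  have "\<gamma> > 0"
    using h_strict_mono[of 1 "a / \<alpha>"] \<alpha> a unfolding \<gamma> a_def[symmetric] by (simp add: h_def)
  have H0: "H0 \<subseteq> {1..m}" and "finite H0"
    using model by (auto simp: sparse_gaussian_model_def intro: finite_subset)
  have indep: "indep_vars (\<lambda>_. borel) X H0"
    using model indep_vars_subset by (auto simp: sparse_gaussian_model_def)
  let ?k = "\<lambda>\<omega>. BH_rejections m (\<lambda>i. Phi_bar (X i \<omega>)) \<alpha>"
  let ?V = "\<lambda>k \<omega>. card {i\<in>H0. X i \<omega> \<in> {x. Phi_bar x \<le> \<alpha> * real k / real m}}"
  \<comment> \<open>\<open>\<theta> = ln (a / \<alpha>)\<close> minimizes the exponent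
    \<open>(exp \<theta> - 1) * \<alpha> - \<theta> * a\<close>; the minimum is
    \<open>- \<gamma>\<close>.\<close>
  let ?E = "\<lambda>k. {\<omega>\<in>space M. ln (a / \<alpha>) * real (?V k \<omega>) \<ge> ln (a / \<alpha>) * (a * real k)}"
  have ln_pos: "ln (a / \<alpha>) > 0"
    using a \<alpha> by simp
  have E_meas: "?E k \<in> events" for k
  proof -
    have [measurable]: "?V k \<in> measurable M (count_space UNIV)"
      using H0 by (intro count_measurable model_measurable[OF model]) auto
    show ?thesis by measurable
  qed
  \<comment> \<open>The BH threshold depends on the random number of rejections; the union over its
    possible values replaces it by fixed thresholds.\<close>
  have sub: "{\<omega>\<in>space M. k0 \<le> ?k \<omega>} \<subseteq> (\<Union>k\<in>{k0..m}. ?E k)"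
  proof
    fix \<omega> assume \<omega>: "\<omega> \<in> {\<omega>\<in>space M. k0 \<le> ?k \<omega>}"
    let ?P = "\<lambda>i. Phi_bar (X i \<omega>) \<le> \<alpha> * real (?k \<omega>) / real m"
    have "?k \<omega> \<le> card {i\<in>{1..m}. ?P i}"
      by (rule BH_rejections_self_consistent)
    also have "\<dots> \<le> card ({i\<in>H0. ?P i} \<union> ({1..m} - H0))"
      using \<open>finite H0\<close> by (intro card_mono) auto
    also have "\<dots> \<le> ?V (?k \<omega>) \<omega> + card ({1..m} - H0)"
      by (rule order.trans[OF card_Un_le]) simp
    finally have "real (?k \<omega>) \<le> real (?V (?k \<omega>) \<omega>) + real (card ({1..m} - H0))"
      by linarith
    moreover have "(1 - \<alpha>) * real k0 \<le> (1 - \<alpha>) * real (?k \<omega>)"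
      using \<omega> \<alpha> by (intro mult_left_mono) auto
    ultimately have "a * real (?k \<omega>) \<le> real (?V (?k \<omega>) \<omega>)"
      using k0 by (simp add: a_def field_simps)
    then have "\<omega> \<in> ?E (?k \<omega>)"
      using \<omega> ln_pos by simp
    moreover have "?k \<omega> \<in> {k0..m}"
      using \<omega> BH_rejections_le by simp
    ultimately show "\<omega> \<in> (\<Union>k\<in>{k0..m}. ?E k)"
      by blast
  qed
  have E_le: "prob (?E k) \<le> exp (- \<gamma>) ^ k" for k
  proof -
    have "(\<Sum>i\<in>H0. prob {\<omega>\<in>space M. X i \<omega> \<in> {x. Phi_bar x \<le> \<alpha> * real k / real m}})
        \<le> (\<Sum>i\<in>H0. \<alpha> * real k / real m)"
      using model \<alpha> by (intro sum_mono) (auto simp: sparse_gaussian_model_def intro!: prob_std_normal_p_value_le)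
    also have "\<dots> = real (card H0) / real m * (\<alpha> * real k)"
      by simp
    also have "\<dots> \<le> 1 * (\<alpha> * real k)"
      using card_mono[OF _ H0] \<alpha> \<open>m \<ge> 1\<close> by (intro mult_right_mono) auto
    finally have mean: "(\<Sum>i\<in>H0. prob {\<omega>\<in>space M. X i \<omega> \<in> {x. Phi_bar x \<le> \<alpha> * real k / real m}}) \<le> \<alpha> * real k"
      by simp
    have "prob (?E k) \<le> exp ((exp (ln (a / \<alpha>)) - 1) *
        (\<Sum>i\<in>H0. prob {\<omega>\<in>space M. X i \<omega> \<in> {x. Phi_bar x \<le> \<alpha> * real k / real m}}) - ln (a / \<alpha>) * (a * real k))"
      by (rule count_chernoff[OF indep \<open>finite H0\<close>]) measurable
    also have "\<dots> \<le> exp ((exp (ln (a / \<alpha>)) - 1) * (\<alpha> * real k) - ln (a / \<alpha>) * (a * real k))"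
      using mean a \<alpha> by (simp add: mult_left_mono)
    also have "(exp (ln (a / \<alpha>)) - 1) * (\<alpha> * real k) - ln (a / \<alpha>) * (a * real k) = real k * (- \<gamma>)"
      using a \<alpha> by (simp add: \<gamma>_eq field_simps)
    also have "exp (real k * (- \<gamma>)) = exp (- \<gamma>) ^ k"
      by (rule exp_of_nat_mult)
    finally show ?thesis .
  qed
  have "prob {\<omega>\<in>space M. k0 \<le> ?k \<omega>} \<le> prob (\<Union>k\<in>{k0..m}. ?E k)"
    by (intro finite_measure_mono[OF sub] sets.finite_UN E_meas finite_atLeastAtMost)
  also have "\<dots> \<le> (\<Sum>k\<in>{k0..m}. prob (?E k))"
    by (intro finite_measure_subadditive_finite image_subsetI E_meas finite_atLeastAtMost)
  also have "\<dots> \<le> (\<Sum>k\<in>{k0..m}. exp (- \<gamma>) ^ k)"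
    by (intro sum_mono E_le)
  also have "\<dots> \<le> exp (- \<gamma>) ^ k0 / (1 - exp (- \<gamma>))"
    using \<open>\<gamma> > 0\<close> by (auto simp: sum_gp divide_right_mono)
  also have "exp (- \<gamma>) ^ k0 = exp (- \<gamma> * real k0)"
    by (simp add: exp_of_nat_mult[symmetric] mult.commute)
  finally show ?thesis .
qed

text \<open>Each alternative exceeds \<open>C + \<mu>\<close> with probability
  \<open>Phi_bar C\<close>. Unless fewer than half of the expected number do so, hypothesis
  \<open>C\<close> puts enough p-values below the BH line to force the rejections. The failure is a
  Chernoff lower tail.\<close>

lemma khat_lower_tail:
  assumes model: "sparse_gaussian_model b c \<beta> m M X H0" and "m \<ge> 1"
    and n: "n = card ({1..m} - H0)" "n \<ge> 1" and \<alpha>: "0 < \<alpha>"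
    and C: "Phi_bar (C + (sqrt (2 * \<beta> * ln (real m)) + b)) \<le> \<alpha> * (Phi_bar C * real n / 2) / real m"
  shows "measure M {\<omega>\<in>space M. real (BH_rejections m (\<lambda>i. Phi_bar (X i \<omega>)) \<alpha>) < Phi_bar C * real n / 2}
    \<le> exp (- ((1 - ln 2) / 2 * (Phi_bar C * real n)))"
proof -
  interpret prob_space M
    using model by (simp add: sparse_gaussian_model_def)
  let ?H1 = "{1..m} - H0"
  define \<mu> where "\<mu> = sqrt (2 * \<beta> * ln (real m)) + b"
  define q where "q = Phi_bar C"
  \<comment> \<open>BH indices are integers: a count of at least \<open>q * n / 2\<close> is a count
    of at least \<open>k0\<close>, and rounding up only raises the BH threshold.\<close>
  define k0 where "k0 = nat \<lceil>q * real n / 2\<rceil>"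
  have q: "0 < q" "q \<le> 1"
    by (auto simp: q_def Phi_bar_pos Phi_bar_le_1)
  have "n \<le> m"
    unfolding n using card_mono[of "{1..m}" ?H1] by auto
  have k0_ge: "q * real n / 2 \<le> real k0"
    unfolding k0_def by linarith
  have "0 < q * real n / 2"
    using q n by simp
  then have k0_pos: "k0 \<ge> 1"
    unfolding k0_def by linarith
  have k0_le: "k0 \<le> s" if "q * real n / 2 \<le> real s" for s
    using that unfolding k0_def by linarith
  have "q * real n \<le> 1 * real n"
    using q by (intro mult_right_mono) auto
  then have "k0 \<le> m"
    using \<open>n \<le> m\<close> by (intro k0_le) linarith
  have indep: "indep_vars (\<lambda>_. borel) X ?H1"
    using model indep_vars_subset[of "\<lambda>_. borel" X "{1..m}" ?H1] by (auto simp: sparse_gaussian_model_def)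
  let ?k = "\<lambda>\<omega>. BH_rejections m (\<lambda>i. Phi_bar (X i \<omega>)) \<alpha>"
  let ?S = "\<lambda>\<omega>. card {i\<in>?H1. X i \<omega> \<in> {C + \<mu>..}}"
  \<comment> \<open>The multiplier \<open>- ln 2\<close> is optimal for falling below half the mean,
    since \<open>exp (- ln 2) = 1/2\<close>; it yields the rate
    \<open>(1 - ln 2) / 2\<close>.\<close>
  let ?E = "{\<omega>\<in>space M. - ln 2 * real (?S \<omega>) \<ge> - ln 2 * (q * real n / 2)}"
  have E_meas: "?E \<in> events"
  proof -
    have [measurable]: "?S \<in> measurable M (count_space UNIV)"
      by (intro count_measurable model_measurable[OF model]) auto
    show ?thesis by measurable
  qed
  have "{\<omega>\<in>space M. real (?k \<omega>) < q * real n / 2} \<subseteq> ?E"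
  proof
    fix \<omega> assume \<omega>: "\<omega> \<in> {\<omega>\<in>space M. real (?k \<omega>) < q * real n / 2}"
    have "real (?S \<omega>) < q * real n / 2"
    proof (rule ccontr)
      assume "\<not> real (?S \<omega>) < q * real n / 2"
      then have "k0 \<le> ?S \<omega>"
        by (intro k0_le) simp
      also have "\<dots> \<le> card {i\<in>{1..m}. Phi_bar (X i \<omega>) \<le> \<alpha> * real k0 / real m}"
      proof (intro card_mono subsetI)
        fix i assume i: "i \<in> {i\<in>?H1. X i \<omega> \<in> {C + \<mu>..}}"
        then have "Phi_bar (X i \<omega>) \<le> Phi_bar (C + \<mu>)"
          by (intro Phi_bar_antimono) auto
        also have "\<dots> \<le> \<alpha> * (q * real n / 2) / real m"
          using C by (simp add: \<mu>_def q_def)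
        also have "\<dots> \<le> \<alpha> * real k0 / real m"
          using k0_ge \<alpha> by (intro divide_right_mono mult_left_mono) auto
        finally show "i \<in> {i\<in>{1..m}. Phi_bar (X i \<omega>) \<le> \<alpha> * real k0 / real m}"
          using i by auto
      qed auto
      finally have "k0 \<le> ?k \<omega>"
        using k0_pos \<open>k0 \<le> m\<close> by (intro BH_rejections_ge) auto
      then show False
        using k0_ge \<omega> by auto
    qed
    then show "\<omega> \<in> ?E"
      using \<omega> by simp
  qed
  then have "prob {\<omega>\<in>space M. real (?k \<omega>) < q * real n / 2} \<le> prob ?E"
    by (intro finite_measure_mono E_meas)
  also have "\<dots> \<le> exp ((exp (- ln 2) - 1) * (\<Sum>i\<in>?H1. prob {\<omega>\<in>space M. X i \<omega> \<in> {C + \<mu>..}})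
      - - ln 2 * (q * real n / 2))"
    by (rule count_chernoff[OF indep]) auto
  also have "(\<Sum>i\<in>?H1. prob {\<omega>\<in>space M. X i \<omega> \<in> {C + \<mu>..}}) = (\<Sum>i\<in>?H1. q)"
    using model prob_shifted_normal_ge[where \<mu> = \<mu> and C = C]
    by (intro sum.cong) (auto simp: sparse_gaussian_model_def \<mu>_def q_def)
  also have "(exp (- ln 2) - 1) * (\<Sum>i\<in>?H1. q) - - ln 2 * (q * real n / 2) =
      - ((1 - ln 2) / 2 * (q * real n))"
    by (simp add: n exp_minus field_simps)
  finally show ?thesis
    by (simp add: q_def)
qed

section \<open>From high-probability events to stochastic orders and consistency\<close>

text \<open>\<open>whp\<close> abbreviates ``with high probability''.\<close>

definition whp :: "(nat \<Rightarrow> 'a measure) \<Rightarrow> (nat \<Rightarrow> 'a \<Rightarrow> nat) \<Rightarrow> (nat \<Rightarrow> nat \<Rightarrow> bool) \<Rightarrow> bool" where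
  "whp M k P \<longleftrightarrow>
     (\<forall>\<^sub>F m in sequentially. prob_space (M m) \<and> k m \<in> measurable (M m) (count_space UNIV)) \<and>
     (\<forall>\<epsilon>>0. \<forall>\<^sub>F m in sequentially. measure (M m) {\<omega>\<in>space (M m). P m (k m \<omega>)} \<ge> 1 - \<epsilon>)"

text \<open>All events are predicates of \<open>k m\<close>, which \<open>whp\<close> requires to be
  measurable into a discrete space; so the larger event is measurable, as monotonicity of the
  measure demands.\<close>

lemma whp_mono:
  assumes P: "whp M k P" and PQ: "\<forall>\<^sub>F m in sequentially. \<forall>j. P m j \<longrightarrow> Q m j"
  shows "whp M k Q"
  unfolding whp_def
proof (intro conjI allI impI)
  show ev: "\<forall>\<^sub>F m in sequentially. prob_space (M m) \<and> k m \<in> measurable (M m) (count_space UNIV)"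
    using P by (simp add: whp_def)
  fix \<epsilon> :: real assume "\<epsilon> > 0"
  then have "\<forall>\<^sub>F m in sequentially. measure (M m) {\<omega>\<in>space (M m). P m (k m \<omega>)} \<ge> 1 - \<epsilon>"
    using P by (simp add: whp_def)
  then show "\<forall>\<^sub>F m in sequentially. measure (M m) {\<omega>\<in>space (M m). Q m (k m \<omega>)} \<ge> 1 - \<epsilon>"
    using ev PQ
  proof eventually_elim
    case (elim m)
    interpret prob_space "M m" using elim by simp
    have [measurable]: "k m \<in> measurable (M m) (count_space UNIV)" using elim by simp
    have "measure (M m) {\<omega>\<in>space (M m). P m (k m \<omega>)} \<le> measure (M m) {\<omega>\<in>space (M m). Q m (k m \<omega>)}"
      using elim by (intro finite_measure_mono) auto
    then show ?case using elim by simp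
  qed
qed

lemma whp_imp_bigO_P:
  assumes "whp M k P" "K > 0"
    and "\<forall>\<^sub>F m in sequentially. \<forall>j. P m j \<longrightarrow> \<bar>f m j\<bar> \<le> K * \<bar>g m j\<bar>"
  shows "bigO_P M (\<lambda>m \<omega>. f m (k m \<omega>)) (\<lambda>m \<omega>. g m (k m \<omega>))"
  using whp_mono[OF assms(1,3)] assms(2) unfolding bigO_P_def whp_def by blast

text \<open>One likely event serves both directions, with constants \<open>c2\<close> and
  \<open>1 / c1\<close>, because \<open>f\<close> depends on the outcome only through
  \<open>k m\<close> and \<open>v\<close> is deterministic.\<close>

lemma whp_imp_asymp_P:
  assumes "whp M k P" "0 < c1" "0 < c2"
    and "\<forall>\<^sub>F m in sequentially. \<forall>j. P m j \<longrightarrow> c1 * v m \<le> f m j \<and> f m j \<le> c2 * v m"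
    and v: "\<forall>\<^sub>F m in sequentially. 0 \<le> v m"
  shows "asymp_P M (\<lambda>m \<omega>. f m (k m \<omega>)) (\<lambda>m _. v m)"
  unfolding asymp_P_def
proof
  show "bigO_P M (\<lambda>m \<omega>. f m (k m \<omega>)) (\<lambda>m _. v m)"
  proof (rule whp_imp_bigO_P[OF assms(1) \<open>0 < c2\<close>, where g = "\<lambda>m _. v m"])
    show "\<forall>\<^sub>F m in sequentially. \<forall>j. P m j \<longrightarrow> \<bar>f m j\<bar> \<le> c2 * \<bar>v m\<bar>"
      using assms(4) v
    proof eventually_elim
      case (elim m)
      have "0 \<le> c1 * v m" using elim \<open>0 < c1\<close> by simp
      then show ?case using elim by (auto intro: order.trans)
    qed
  qed
  show "bigO_P M (\<lambda>m _. v m) (\<lambda>m \<omega>. f m (k m \<omega>))"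
  proof (rule whp_imp_bigO_P[OF assms(1), where K = "1 / c1" and f = "\<lambda>m _. v m"])
    show "\<forall>\<^sub>F m in sequentially. \<forall>j. P m j \<longrightarrow> \<bar>v m\<bar> \<le> 1 / c1 * \<bar>f m j\<bar>"
      using assms(4) v
    proof eventually_elim
      case (elim m)
      have "v m \<le> 1 / c1 * f m j" if "P m j" for j
        using elim that \<open>0 < c1\<close> by (simp add: field_simps)
      moreover have "1 / c1 * f m j \<le> 1 / c1 * \<bar>f m j\<bar>" for j
        using \<open>0 < c1\<close> by (intro mult_left_mono) auto
      ultimately show ?case
        using elim by (metis abs_of_nonneg order.trans)
    qed
  qed (use \<open>0 < c1\<close> in simp)
qed

text \<open>On the likely event the excess is at most \<open>v m\<close>, eventually below any
  \<open>\<epsilon>\<close>; an excess of at least \<open>\<epsilon>\<close> is then confined to the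
  complement.\<close>

lemma whp_imp_BH_m_consistent:
  assumes P: "whp M k P"
    and le: "\<forall>\<^sub>F m in sequentially. \<forall>j. P m j \<longrightarrow> F m j - \<alpha> \<le> v m" and v: "v \<longlonglongrightarrow> 0"
  shows "BH_m_consistent M \<alpha> (\<lambda>m \<omega>. F m (k m \<omega>))"
  unfolding BH_m_consistent_def
proof (intro allI impI)
  fix \<epsilon> :: real assume "\<epsilon> > 0"
  have "whp M k (\<lambda>m j. \<not> F m j - \<alpha> \<ge> \<epsilon>)"
  proof (rule whp_mono[OF P])
    show "\<forall>\<^sub>F m in sequentially. \<forall>j. P m j \<longrightarrow> \<not> F m j - \<alpha> \<ge> \<epsilon>"
      using le order_tendstoD(2)[OF v \<open>\<epsilon> > 0\<close>] by eventually_elim force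
  qed
  then have ev: "\<forall>\<^sub>F m in sequentially. prob_space (M m) \<and> k m \<in> measurable (M m) (count_space UNIV)"
    and lim: "\<And>\<eta>. \<eta> > 0 \<Longrightarrow> \<forall>\<^sub>F m in sequentially.
      measure (M m) {\<omega>\<in>space (M m). \<not> F m (k m \<omega>) - \<alpha> \<ge> \<epsilon>} \<ge> 1 - \<eta>"
    by (auto simp: whp_def)
  show "(\<lambda>m. measure (M m) {\<omega>\<in>space (M m). F m (k m \<omega>) - \<alpha> \<ge> \<epsilon>}) \<longlonglongrightarrow> 0"
  proof (rule tendstoI)
    fix \<eta> :: real assume "\<eta> > 0"
    show "\<forall>\<^sub>F m in sequentially. dist (measure (M m) {\<omega>\<in>space (M m). F m (k m \<omega>) - \<alpha> \<ge> \<epsilon>}) 0 < \<eta>"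
      using ev lim[OF half_gt_zero[OF \<open>\<eta> > 0\<close>]]
    proof eventually_elim
      case (elim m)
      interpret prob_space "M m" using elim by simp
      have [measurable]: "k m \<in> measurable (M m) (count_space UNIV)" using elim by simp
      have "prob {\<omega>\<in>space (M m). \<not> F m (k m \<omega>) - \<alpha> \<ge> \<epsilon>} =
          1 - prob {\<omega>\<in>space (M m). F m (k m \<omega>) - \<alpha> \<ge> \<epsilon>}"
        by (rule prob_neg) measurable
      then show ?case
        using elim \<open>\<eta> > 0\<close> by simp
    qed
  qed
qed

text \<open>A fixed excess on events of probability eventually at least 1/2 contradicts the limit
  0.\<close>

lemma whp_imp_not_BH_m_consistent:
  assumes P: "whp M k P" and "\<epsilon> > 0"
    and ge: "\<forall>\<^sub>F m in sequentially. \<forall>j. P m j \<longrightarrow> \<epsilon> \<le> F m j - \<alpha>"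
  shows "\<not> BH_m_consistent M \<alpha> (\<lambda>m \<omega>. F m (k m \<omega>))"
proof
  assume "BH_m_consistent M \<alpha> (\<lambda>m \<omega>. F m (k m \<omega>))"
  then have "(\<lambda>m. measure (M m) {\<omega>\<in>space (M m). \<epsilon> \<le> F m (k m \<omega>) - \<alpha>}) \<longlonglongrightarrow> 0"
    using \<open>\<epsilon> > 0\<close> by (simp add: BH_m_consistent_def)
  then have "\<forall>\<^sub>F m in sequentially. measure (M m) {\<omega>\<in>space (M m). \<epsilon> \<le> F m (k m \<omega>) - \<alpha>} < 1 / 2"
    by (rule order_tendstoD) simp
  moreover have "\<forall>\<^sub>F m in sequentially. measure (M m) {\<omega>\<in>space (M m). \<epsilon> \<le> F m (k m \<omega>) - \<alpha>} \<ge> 1 - 1 / 2"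
    using conjunct2[OF whp_mono[OF P ge, unfolded whp_def], rule_format, of "1 / 2"] by simp
  ultimately have "\<forall>\<^sub>F m in sequentially :: nat filter. False"
    by eventually_elim simp
  then show False
    by simp
qed

section \<open>The number of rejections has order \<open>m powr (1 - \<beta>)\<close>\<close>

definition rejection_window :: "real \<Rightarrow> real \<Rightarrow> real \<Rightarrow> nat \<Rightarrow> nat \<Rightarrow> bool" where
  "rejection_window A B \<beta> m j \<longleftrightarrow>
     A * real m powr (1 - \<beta>) \<le> real j \<and> real j \<le> B * real m powr (1 - \<beta>) \<and> j \<le> m"

text \<open>Both tail bounds are used at fixed multiples of
  \<open>r m = m powr (1 - \<beta>)\<close>. Their failure probabilities are exponentially small in
  \<open>r m\<close>, which diverges because \<open>\<beta> < 1\<close>.\<close>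

lemma khat_order:
  assumes "b > 0" "0 < c" "c < 1" "0 \<le> \<beta>" "\<beta> < 1"
    and model: "\<And>m. m \<ge> 1 \<Longrightarrow> sparse_gaussian_model b c \<beta> m (M m) (X m) (H0 m)"
    and \<alpha>: "0 < \<alpha>" "\<alpha> < 1"
  obtains A B where "A > 0" "B > 0"
    "whp M (\<lambda>m \<omega>. BH_rejections m (\<lambda>i. Phi_bar (X m i \<omega>)) \<alpha>) (rejection_window A B \<beta>)"
proof -
  let ?k = "\<lambda>m \<omega>. BH_rejections m (\<lambda>i. Phi_bar (X m i \<omega>)) \<alpha>"
  define r where "r m = real m powr (1 - \<beta>)" for m :: nat
  define n where "n m = card ({1..m} - H0 m)" for m
  \<comment> \<open>\<open>C\<close> solves \<open>exp (- b * C) = \<alpha> * c / 4\<close>, which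
    is possible since \<open>b > 0\<close>. The p-value at \<open>\<mu> + C\<close> is then at most
    \<open>\<alpha> * k / m\<close> for \<open>k = q * c * r m / 4\<close>.\<close>
  define C where "C = ln (4 / (\<alpha> * c)) / b"
  define q where "q = Phi_bar C"
  \<comment> \<open>One factor 1/2 comes from keeping half of the expected \<open>q * n m\<close>
    large alternatives, the other from \<open>n m \<ge> c * r m / 2\<close>.\<close>
  define A where "A = q * c / 4"
  \<comment> \<open>Since \<open>n m \<le> r m\<close>, every \<open>k0 \<ge> B * r m\<close> meets
    the condition of the upper tail bound.\<close>
  define B where "B = 2 / (1 - \<alpha>)"
  define \<gamma> where "\<gamma> = \<alpha> * h (((1 + \<alpha>) / 2) / \<alpha>)"
  have "q > 0"
    by (simp add: q_def Phi_bar_pos)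
  have "\<alpha> * c < 1"
    using mult_strict_mono[of \<alpha> 1 c 1] \<alpha> assms by simp
  then have "C \<ge> 0"
    using \<alpha> assms by (auto simp: C_def field_simps intro!: divide_nonneg_pos)
  have exp_C: "exp (- b * C) = \<alpha> * c / 4"
    using \<alpha> assms by (simp add: C_def exp_minus)
  have "\<gamma> > 0"
  proof -
    have "1 < ((1 + \<alpha>) / 2) / \<alpha>"
      using \<alpha> by (simp add: field_simps)
    then have "0 < h (((1 + \<alpha>) / 2) / \<alpha>)"
      using h_strict_mono[OF order_refl] by (force simp: h_def[of 1])
    then show ?thesis
      using \<alpha> by (simp add: \<gamma>_def)
  qed
  have r_top: "filterlim r at_top sequentially"
    unfolding r_def using \<open>\<beta> < 1\<close> by real_asymp
  have n_bounds: "real (n m) \<le> c * r m" "c * r m - 1 \<le> real (n m)" if "m \<ge> 1" for m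
  proof -
    have "int (n m) = \<lfloor>c * r m\<rfloor>"
      using model[OF that] by (simp add: sparse_gaussian_model_def n_def r_def)
    then show "real (n m) \<le> c * r m" "c * r m - 1 \<le> real (n m)"
      by linarith+
  qed
  have upper: "measure (M m) {\<omega>\<in>space (M m). real (?k m \<omega>) > B * r m} \<le> exp (- \<gamma> * (B * r m)) / (1 - exp (- \<gamma>))"
    if "m \<ge> 1" for m
  proof -
    interpret prob_space "M m"
      using model[OF that] by (simp add: sparse_gaussian_model_def)
    note [measurable] = model_khat_measurable[OF model[OF that], of \<alpha>]
    define k0 where "k0 = nat \<lceil>B * r m\<rceil>"
    have "r m \<ge> 0" by (simp add: r_def)
    have k0: "B * r m \<le> real k0"
      unfolding k0_def by linarith
    have "2 * real (n m) \<le> 2 * (1 * r m)"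
      using n_bounds[OF that] assms \<open>r m \<ge> 0\<close> mult_right_mono[of c 1 "r m"] by linarith
    also have "\<dots> = (1 - \<alpha>) * (B * r m)"
      using \<alpha> by (simp add: B_def)
    also have "\<dots> \<le> (1 - \<alpha>) * real k0"
      using k0 \<alpha> by (intro mult_left_mono) auto
    finally have n_le: "2 * real (n m) \<le> (1 - \<alpha>) * real k0" .
    have "prob {\<omega>\<in>space (M m). real (?k m \<omega>) > B * r m} \<le> prob {\<omega>\<in>space (M m). k0 \<le> ?k m \<omega>}"
    proof (rule finite_measure_mono)
      show "{\<omega>\<in>space (M m). real (?k m \<omega>) > B * r m} \<subseteq> {\<omega>\<in>space (M m). k0 \<le> ?k m \<omega>}"
        unfolding k0_def by auto
    qed measurable
    also have "\<dots> \<le> exp (- \<gamma> * real k0) / (1 - exp (- \<gamma>))"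
      using n_le that \<alpha> by (intro khat_upper_tail[OF model[OF that]]) (auto simp: \<gamma>_def n_def)
    also have "\<dots> \<le> exp (- \<gamma> * (B * r m)) / (1 - exp (- \<gamma>))"
      using k0 \<open>\<gamma> > 0\<close> by (intro divide_right_mono) auto
    finally show ?thesis .
  qed
  have lower: "measure (M m) {\<omega>\<in>space (M m). real (?k m \<omega>) < A * r m} \<le> exp (- ((1 - ln 2) / 2 * (q * (c * r m / 2))))"
    if "m \<ge> 1" and large: "c * r m \<ge> 2" for m
  proof -
    interpret prob_space "M m"
      using model[OF that(1)] by (simp add: sparse_gaussian_model_def)
    note [measurable] = model_khat_measurable[OF model[OF that(1)], of \<alpha>]
    \<comment> \<open>The loss of at most 1 from the floor is absorbed by half of
      \<open>c * r m\<close>, which is at least 1.\<close>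
    have n_ge: "c * r m / 2 \<le> real (n m)"
      using n_bounds[OF that(1)] large by linarith
    then have n1: "n m \<ge> 1"
      using large by linarith
    define \<mu> where "\<mu> = sqrt (2 * \<beta> * ln (real m)) + b"
    have ln_nonneg: "0 \<le> 2 * \<beta> * ln (real m)"
      using \<open>m \<ge> 1\<close> \<open>0 \<le> \<beta>\<close> by simp
    then have "\<mu> \<ge> b"
      by (simp add: \<mu>_def)
    \<comment> \<open>The square of \<open>\<mu>\<close> contributes the sparsity factor
      \<open>m powr (- \<beta>)\<close>; the shift \<open>b\<close> enters through the cross term
      \<open>\<mu> * C \<ge> b * C\<close>.\<close>
    have "(sqrt (2 * \<beta> * ln (real m)))\<^sup>2 \<le> \<mu>\<^sup>2"
      using \<open>b > 0\<close> ln_nonneg by (intro power_mono) (auto simp: \<mu>_def)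
    then have sq: "\<beta> * ln (real m) \<le> \<mu>\<^sup>2 / 2"
      using ln_nonneg by simp
    have "Phi_bar (C + \<mu>) \<le> exp (- \<mu> * C - \<mu>\<^sup>2 / 2) * q"
      unfolding q_def using \<open>C \<ge> 0\<close> \<open>\<mu> \<ge> b\<close> \<open>b > 0\<close> by (intro Phi_bar_add_le) auto
    also have "\<dots> \<le> exp (- b * C - \<beta> * ln (real m)) * q"
    proof -
      have "b * C \<le> \<mu> * C"
        using \<open>\<mu> \<ge> b\<close> \<open>C \<ge> 0\<close> by (rule mult_right_mono)
      then show ?thesis
        using sq \<open>q > 0\<close> by (intro mult_right_mono) auto
    qed
    also have "\<dots> = \<alpha> * c / 4 * real m powr (- \<beta>) * q"
      using \<open>m \<ge> 1\<close> exp_C by (simp add: exp_diff exp_minus powr_def field_simps)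
    also have "real m powr (- \<beta>) = r m / real m"
      using \<open>m \<ge> 1\<close> by (simp add: r_def powr_diff powr_minus field_simps)
    also have "\<alpha> * c / 4 * (r m / real m) * q = \<alpha> * (q * (c * r m / 2) / 2) / real m"
      by simp
    also have "\<dots> \<le> \<alpha> * (q * real (n m) / 2) / real m"
      using n_ge \<alpha> \<open>q > 0\<close> by (intro divide_right_mono mult_left_mono) auto
    finally have thr: "Phi_bar (C + \<mu>) \<le> \<alpha> * (q * real (n m) / 2) / real m" .
    have "A * r m = q * (c * r m / 2) / 2"
      by (simp add: A_def)
    also have "\<dots> \<le> q * real (n m) / 2"
      using n_ge \<open>q > 0\<close> by (intro divide_right_mono mult_left_mono) auto
    finally have A_le: "A * r m \<le> q * real (n m) / 2" .
    have "prob {\<omega>\<in>space (M m). real (?k m \<omega>) < A * r m} \<le> prob {\<omega>\<in>space (M m). real (?k m \<omega>) < q * real (n m) / 2}"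
      using A_le by (intro finite_measure_mono) auto
    also have "\<dots> \<le> exp (- ((1 - ln 2) / 2 * (q * real (n m))))"
      using khat_lower_tail[OF model[OF that(1)] that(1) n_def n1 \<alpha>(1), of C] thr by (simp add: q_def \<mu>_def)
    also have "\<dots> \<le> exp (- ((1 - ln 2) / 2 * (q * (c * r m / 2))))"
      using n_ge \<open>q > 0\<close> ln_2_less_1 by (simp add: mult_left_mono)
    finally show ?thesis .
  qed
  have "A > 0" "B > 0"
    using \<open>q > 0\<close> assms by (auto simp: A_def B_def)
  have lim1: "(\<lambda>m. exp (- \<gamma> * (B * r m)) / (1 - exp (- \<gamma>))) \<longlonglongrightarrow> 0"
  proof -
    have "((\<lambda>x. exp (- \<gamma> * (B * x)) / (1 - exp (- \<gamma>))) \<longlongrightarrow> 0) at_top"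
      using \<open>\<gamma> > 0\<close> \<open>B > 0\<close> by real_asymp
    then show ?thesis
      using r_top by (rule filterlim_compose)
  qed
  have lim2: "(\<lambda>m. exp (- ((1 - ln 2) / 2 * (q * (c * r m / 2))))) \<longlonglongrightarrow> 0"
  proof -
    define d where "d = (1 - ln 2) / 2 * (q * (c / 2))"
    have "d > 0"
      using \<open>q > 0\<close> assms ln_2_less_1 by (simp add: d_def)
    then have "((\<lambda>x. exp (- (d * x))) \<longlongrightarrow> 0) at_top"
      by real_asymp
    from filterlim_compose[OF this r_top] show ?thesis
      by (simp add: d_def mult.assoc)
  qed
  have "whp M ?k (rejection_window A B \<beta>)"
    unfolding whp_def
  proof (intro conjI allI impI)
    show "\<forall>\<^sub>F m in sequentially. prob_space (M m) \<and> ?k m \<in> measurable (M m) (count_space UNIV)"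
      using eventually_ge_at_top[of 1]
    proof eventually_elim
      case (elim m)
      show ?case
        using model[OF elim] model_khat_measurable[OF model[OF elim]] by (simp add: sparse_gaussian_model_def)
    qed
    fix \<epsilon> :: real assume "\<epsilon> > 0"
    then have "\<forall>\<^sub>F m in sequentially. exp (- \<gamma> * (B * r m)) / (1 - exp (- \<gamma>)) < \<epsilon> / 2"
      "\<forall>\<^sub>F m in sequentially. exp (- ((1 - ln 2) / 2 * (q * (c * r m / 2)))) < \<epsilon> / 2"
      using order_tendstoD(2)[OF lim1, of "\<epsilon> / 2"] order_tendstoD(2)[OF lim2, of "\<epsilon> / 2"] by auto
    moreover have "\<forall>\<^sub>F m in sequentially. r m \<ge> 2 / c"
      using r_top by (simp add: filterlim_at_top)
    ultimately show "\<forall>\<^sub>F m in sequentially.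
        1 - \<epsilon> \<le> measure (M m) {\<omega>\<in>space (M m). rejection_window A B \<beta> m (?k m \<omega>)}"
      using eventually_ge_at_top[of 1]
    proof eventually_elim
      case (elim m)
      interpret prob_space "M m"
        using model[OF \<open>1 \<le> m\<close>] by (simp add: sparse_gaussian_model_def)
      note [measurable] = model_khat_measurable[OF model[OF \<open>1 \<le> m\<close>], of \<alpha>]
      let ?U = "{\<omega>\<in>space (M m). real (?k m \<omega>) > B * r m}" and ?L = "{\<omega>\<in>space (M m). real (?k m \<omega>) < A * r m}"
      have "c * r m \<ge> 2"
        using elim \<open>0 < c\<close> by (simp add: field_simps)
      then have "prob ?U < \<epsilon> / 2" "prob ?L < \<epsilon> / 2"
        using upper[of m] lower[of m] elim by linarith+
      moreover have "prob (?U \<union> ?L) \<le> prob ?U + prob ?L"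
        by (rule measure_Un_le) measurable
      moreover have "{\<omega>\<in>space (M m). rejection_window A B \<beta> m (?k m \<omega>)} = space (M m) - (?U \<union> ?L)"
        by (auto simp: rejection_window_def r_def BH_rejections_le)
      moreover have "prob (space (M m) - (?U \<union> ?L)) = 1 - prob (?U \<union> ?L)"
        by (rule prob_compl) measurable
      ultimately show ?case
        by simp
    qed
  qed
  with \<open>A > 0\<close> \<open>B > 0\<close> show thesis
    by (rule that)
qed

section \<open>Orders of the two bounds\<close>

text \<open>Positivity of the lower end makes \<open>j \<ge> 1\<close>, so in both bounds the
  indicator is 1 and \<open>max 1 j\<close> is \<open>j\<close>.\<close>

lemma rejection_windowD:
  assumes "rejection_window A B \<beta> m j" "A > 0" "m \<ge> 1"
  shows "1 \<le> j" "j \<le> m" "A * real m powr (1 - \<beta>) \<le> real j" "real j \<le> B * real m powr (1 - \<beta>)"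
proof -
  have "0 < A * real m powr (1 - \<beta>)"
    using assms by simp
  also have "\<dots> \<le> real j"
    using assms by (simp add: rejection_window_def)
  finally show "1 \<le> j"
    by simp
qed (use assms in \<open>auto simp: rejection_window_def\<close>)

text \<open>The excess is \<open>sqrt m * D / j\<close> with \<open>j\<close> of order
  \<open>m powr (1 - \<beta>)\<close>, and the exponents add up to
  \<open>1/2 - (1 - \<beta>) = -1/2 + \<beta>\<close>.\<close>

lemma DKW_uncapped_bounds:
  assumes win: "rejection_window A B \<beta> m j" and A: "A > 0" "B > 0" and "m \<ge> 1" and "0 < \<delta>" "\<delta> < 1"
    and D: "D = sqrt (0.5 * ln (1 / \<delta>))"
  shows "D / B * real m powr (-1/2 + \<beta>) \<le> DKW_uncapped \<delta> \<alpha> m j - \<alpha>"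
    and "DKW_uncapped \<delta> \<alpha> m j - \<alpha> \<le> D / A * real m powr (-1/2 + \<beta>)"
proof -
  define r where "r = real m powr (1 - \<beta>)"
  note j = rejection_windowD[OF win \<open>A > 0\<close> \<open>m \<ge> 1\<close>, folded r_def]
  have "r > 0"
    using \<open>m \<ge> 1\<close> by (simp add: r_def)
  have "D \<ge> 0"
    using assms by (simp add: D)
  have eq: "DKW_uncapped \<delta> \<alpha> m j - \<alpha> = sqrt (real m) * D / real j"
    using j(1) by (simp add: DKW_uncapped_def D)
  have "sqrt (real m) / r = real m powr (1/2 - (1 - \<beta>))"
    unfolding r_def powr_diff using \<open>m \<ge> 1\<close> by (simp add: powr_half_sqrt)
  then have w: "sqrt (real m) / r = real m powr (-1/2 + \<beta>)"
    by (simp add: algebra_simps)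
  have "D / B * real m powr (-1/2 + \<beta>) = sqrt (real m) * D / (B * r)"
    unfolding w[symmetric] by simp
  also have "\<dots> \<le> sqrt (real m) * D / real j"
    using j \<open>D \<ge> 0\<close> \<open>r > 0\<close> A by (intro divide_left_mono mult_pos_pos) auto
  finally show "D / B * real m powr (-1/2 + \<beta>) \<le> DKW_uncapped \<delta> \<alpha> m j - \<alpha>"
    by (simp add: eq)
  have "sqrt (real m) * D / real j \<le> sqrt (real m) * D / (A * r)"
    using j \<open>D \<ge> 0\<close> \<open>r > 0\<close> A by (intro divide_left_mono mult_pos_pos) auto
  also have "\<dots> = D / A * real m powr (-1/2 + \<beta>)"
    unfolding w[symmetric] by simp
  finally show "DKW_uncapped \<delta> \<alpha> m j - \<alpha> \<le> D / A * real m powr (-1/2 + \<beta>)"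
    by (simp add: eq)
qed

lemma FDP_DKW_eq: "j \<ge> 1 \<Longrightarrow> FDP_DKW \<delta> \<alpha> m j - \<alpha> = min (1 - \<alpha>) (DKW_uncapped \<delta> \<alpha> m j - \<alpha>)"
  by (simp add: FDP_DKW_def min_diff_distrib_left)

text \<open>The numerator in the argument of \<open>h_inv\<close>, with \<open>j\<close> for
  \<open>max 1 j\<close>; it is compared with \<open>FDP_Well\<close> only for
  \<open>j \<ge> 1\<close>.\<close>

definition Well_numerator :: "real \<Rightarrow> real \<Rightarrow> nat \<Rightarrow> nat \<Rightarrow> real" where
  "Well_numerator \<delta> \<alpha> m j =
     2 * ln ((pi\<^sup>2 / 6) / \<delta>) + 4 * ln (1 + log 2 (real m / (\<alpha> * real j)))"

text \<open>The excess is the minimum of \<open>1 - \<alpha>\<close> and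
  \<open>\<alpha> * (h_inv x - 1)\<close>, and \<open>h_inv x - 1\<close> is comparable to
  \<open>sqrt x\<close>. The upper estimate drops the cap, the lower one keeps it.\<close>

lemma FDP_Well_bounds:
  assumes \<alpha>: "0 < \<alpha>" and "j \<ge> 1" and x: "x = Well_numerator \<delta> \<alpha> m j / (\<alpha> * real j)" "x > 0"
  shows "min (1 - \<alpha>) (\<alpha> * sqrt x) \<le> FDP_Well \<delta> \<alpha> m j - \<alpha>"
    and "x \<le> 1 / 4 \<Longrightarrow> FDP_Well \<delta> \<alpha> m j - \<alpha> \<le> 2 * \<alpha> * sqrt x"
proof -
  have eq: "FDP_Well \<delta> \<alpha> m j - \<alpha> = min (1 - \<alpha>) (\<alpha> * (h_inv x - 1))"
    using \<open>j \<ge> 1\<close>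
    by (simp add: FDP_Well_def x(1) Well_numerator_def min_diff_distrib_left algebra_simps)
  have "\<alpha> * sqrt x \<le> \<alpha> * (h_inv x - 1)"
    using h_inv_ge[OF x(2)] \<alpha> by (intro mult_left_mono) auto
  then show "min (1 - \<alpha>) (\<alpha> * sqrt x) \<le> FDP_Well \<delta> \<alpha> m j - \<alpha>"
    unfolding eq by (intro min.mono) auto
  assume "x \<le> 1 / 4"
  then have "\<alpha> * (h_inv x - 1) \<le> \<alpha> * (2 * sqrt x)"
    using h_inv_le[OF x(2)] \<alpha> by (intro mult_left_mono) auto
  then show "FDP_Well \<delta> \<alpha> m j - \<alpha> \<le> 2 * \<alpha> * sqrt x"
    unfolding eq by (simp add: min.coboundedI2)
qed

text \<open>Written for a general order \<open>ell\<close> of the numerator so as to serve both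
  \<open>\<beta> > 0\<close> (\<open>ell = ln (ln m)\<close>) and \<open>\<beta> = 0\<close>
  (\<open>ell = 1\<close>). The argument \<open>x\<close> of \<open>h_inv\<close> is then of order
  \<open>ell m / m powr (1 - \<beta>)\<close> and tends to 0.\<close>

lemma FDP_Well_order:
  assumes A: "A > 0" "B > 0" and \<alpha>: "0 < \<alpha>" "\<alpha> < 1" and c: "c1 > 0" "c2 > 0"
    and ell_pos: "\<forall>\<^sub>F m in sequentially. 0 < ell m"
    and num: "\<forall>\<^sub>F m in sequentially. \<forall>j. rejection_window A B \<beta> m j \<longrightarrow>
      c1 * ell m \<le> Well_numerator \<delta> \<alpha> m j \<and> Well_numerator \<delta> \<alpha> m j \<le> c2 * ell m"
    and lim: "(\<lambda>m. ell m / real m powr (1 - \<beta>)) \<longlonglongrightarrow> 0"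
  shows "\<forall>\<^sub>F m in sequentially. \<forall>j. rejection_window A B \<beta> m j \<longrightarrow>
      \<alpha> * sqrt (c1 / (\<alpha> * B)) * sqrt (ell m / real m powr (1 - \<beta>)) \<le> FDP_Well \<delta> \<alpha> m j - \<alpha> \<and>
      FDP_Well \<delta> \<alpha> m j - \<alpha> \<le> 2 * \<alpha> * sqrt (c2 / (\<alpha> * A)) * sqrt (ell m / real m powr (1 - \<beta>))"
proof -
  have "(\<lambda>m. c2 / (\<alpha> * A) * (ell m / real m powr (1 - \<beta>))) \<longlonglongrightarrow> c2 / (\<alpha> * A) * 0"
    by (intro tendsto_intros lim)
  \<comment> \<open>This puts \<open>x\<close> into the range \<open>x \<le> 1/4\<close> of the
    upper estimate for \<open>h_inv\<close>.\<close>
  then have small2: "\<forall>\<^sub>F m in sequentially. c2 / (\<alpha> * A) * (ell m / real m powr (1 - \<beta>)) < 1 / 4"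
    by (rule order_tendstoD) simp
  have "(\<lambda>m. \<alpha> * sqrt (c1 / (\<alpha> * B)) * sqrt (ell m / real m powr (1 - \<beta>)))
      \<longlonglongrightarrow> \<alpha> * sqrt (c1 / (\<alpha> * B)) * sqrt 0"
    by (intro tendsto_intros lim)
  \<comment> \<open>The claimed lower bound stays below the cap \<open>1 - \<alpha>\<close>, so the
    cap cannot spoil it.\<close>
  then have small1: "\<forall>\<^sub>F m in sequentially.
      \<alpha> * sqrt (c1 / (\<alpha> * B)) * sqrt (ell m / real m powr (1 - \<beta>)) < 1 - \<alpha>"
    by (rule order_tendstoD) (use \<alpha> in simp)
  show ?thesis
    using small1 small2 ell_pos num eventually_ge_at_top[of 1]
  proof eventually_elim
    case (elim m)
    define r where "r = real m powr (1 - \<beta>)"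
    have "r > 0"
      using \<open>1 \<le> m\<close> by (simp add: r_def)
    show ?case
    proof (intro allI impI)
      fix j assume win: "rejection_window A B \<beta> m j"
      note j = rejection_windowD[OF win \<open>A > 0\<close> \<open>1 \<le> m\<close>, folded r_def]
      define L where "L = Well_numerator \<delta> \<alpha> m j"
      define x where "x = L / (\<alpha> * real j)"
      have L: "c1 * ell m \<le> L" "L \<le> c2 * ell m"
        using elim win by (auto simp: L_def)
      have "0 < c1 * ell m"
        using elim c by simp
      with L have "L > 0"
        by linarith
      then have "x > 0"
        using \<alpha> j by (simp add: x_def)
      have "c1 / (\<alpha> * B) * (ell m / r) = c1 * ell m / (\<alpha> * (B * r))"
        by simp
      also have "\<dots> \<le> x"
        unfolding x_def using L j \<alpha> A \<open>r > 0\<close> \<open>L > 0\<close>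
        by (intro frac_le mult_left_mono mult_pos_pos) auto
      finally have x_ge: "c1 / (\<alpha> * B) * (ell m / r) \<le> x" .
      have "x \<le> c2 * ell m / (\<alpha> * (A * r))"
        unfolding x_def using L j \<alpha> A \<open>r > 0\<close> \<open>L > 0\<close>
        by (intro frac_le mult_left_mono mult_pos_pos) auto
      also have "\<dots> = c2 / (\<alpha> * A) * (ell m / r)"
        by simp
      finally have x_le: "x \<le> c2 / (\<alpha> * A) * (ell m / r)" .
      have "\<alpha> * sqrt (c1 / (\<alpha> * B)) * sqrt (ell m / r) = \<alpha> * sqrt (c1 / (\<alpha> * B) * (ell m / r))"
        by (simp only: real_sqrt_mult mult.assoc)
      also have "\<dots> \<le> \<alpha> * sqrt x"
        using x_ge \<alpha> by (intro mult_left_mono real_sqrt_le_mono) auto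
      finally have "\<alpha> * sqrt (c1 / (\<alpha> * B)) * sqrt (ell m / r) \<le> min (1 - \<alpha>) (\<alpha> * sqrt x)"
        using elim by (simp add: r_def)
      also have "\<dots> \<le> FDP_Well \<delta> \<alpha> m j - \<alpha>"
        by (rule FDP_Well_bounds[OF \<alpha>(1) j(1) x_def[unfolded L_def] \<open>x > 0\<close>])
      finally have lower: "\<alpha> * sqrt (c1 / (\<alpha> * B)) * sqrt (ell m / r) \<le> FDP_Well \<delta> \<alpha> m j - \<alpha>" .
      have "x \<le> 1 / 4"
        using x_le elim(2) unfolding r_def by linarith
      then have "FDP_Well \<delta> \<alpha> m j - \<alpha> \<le> 2 * \<alpha> * sqrt x"
        by (rule FDP_Well_bounds(2)[OF \<alpha>(1) j(1) x_def[unfolded L_def] \<open>x > 0\<close>])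
      also have "\<dots> \<le> 2 * \<alpha> * sqrt (c2 / (\<alpha> * A) * (ell m / r))"
        using x_le \<alpha> by (intro mult_left_mono real_sqrt_le_mono) auto
      also have "\<dots> = 2 * \<alpha> * sqrt (c2 / (\<alpha> * A)) * sqrt (ell m / r)"
        by (simp only: real_sqrt_mult mult.assoc)
      finally show "\<alpha> * sqrt (c1 / (\<alpha> * B)) * sqrt (ell m / real m powr (1 - \<beta>)) \<le> FDP_Well \<delta> \<alpha> m j - \<alpha> \<and>
          FDP_Well \<delta> \<alpha> m j - \<alpha> \<le> 2 * \<alpha> * sqrt (c2 / (\<alpha> * A)) * sqrt (ell m / real m powr (1 - \<beta>))"
        using lower by (simp add: r_def)
    qed
  qed
qed

text \<open>From \<open>pi > 3\<close> one gets \<open>pi^2 / 6 > 9 / 6\<close>. The constant part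
  of the Wellner numerator is therefore positive, which supplies its lower bound when
  \<open>\<beta> = 0\<close>.\<close>

lemma ln_kappa_over_delta_pos:
  assumes "0 < \<delta>" "\<delta> < 1"
  shows "0 < ln ((pi\<^sup>2 / 6) / \<delta>)"
proof -
  have "3\<^sup>2 < pi\<^sup>2"
    using pi_gt3 by (intro power_strict_mono) auto
  then have "1 < pi\<^sup>2 / 6"
    by simp
  also have "\<dots> \<le> (pi\<^sup>2 / 6) / \<delta>"
    using assms by (simp add: field_simps)
  finally show ?thesis
    by (rule ln_gt_zero)
qed

text \<open>In the window \<open>m / (\<alpha> * j)\<close> has order \<open>m powr \<beta>\<close>,
  its logarithm has order \<open>ln m\<close>, and the numerator is asymptotically
  \<open>4 * ln (ln m)\<close>; the factors 1 and 5 leave room for lower-order terms.\<close>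

lemma Well_numerator_order_sparse:
  assumes A: "A > 0" "B > 0" and "0 < \<alpha>" and "\<beta> > 0" and \<delta>: "0 < \<delta>" "\<delta> < 1"
  shows "\<forall>\<^sub>F m in sequentially. \<forall>j. rejection_window A B \<beta> m j \<longrightarrow>
      1 * ln (ln (real m)) \<le> Well_numerator \<delta> \<alpha> m j \<and> Well_numerator \<delta> \<alpha> m j \<le> 5 * ln (ln (real m))"
proof -
  define l where "l = ln ((pi\<^sup>2 / 6) / \<delta>)"
  have "l > 0"
    unfolding l_def by (rule ln_kappa_over_delta_pos[OF \<delta>])
  define a1 a2 where "a1 = \<alpha> * B" and "a2 = \<alpha> * A"
  have a: "a1 > 0" "a2 > 0"
    using assms by (auto simp: a1_def a2_def)
  \<comment> \<open>The first fact keeps the logarithms nonnegative; the other two compare the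
    numerator at the ends of the window with \<open>ln (ln m)\<close>.\<close>
  have "\<forall>\<^sub>F m in sequentially. real m powr \<beta> / a1 \<ge> 1"
    using \<open>\<beta> > 0\<close> a by real_asymp
  moreover have "\<forall>\<^sub>F m in sequentially. ln (ln (real m)) \<le> 4 * ln (1 + log 2 (real m powr \<beta> / a1))"
    using \<open>\<beta> > 0\<close> a by real_asymp
  moreover have "\<forall>\<^sub>F m in sequentially. 2 * l + 4 * ln (1 + log 2 (real m powr \<beta> / a2)) \<le> 5 * ln (ln (real m))"
    using \<open>\<beta> > 0\<close> a by real_asymp
  ultimately show ?thesis
    using eventually_ge_at_top[of 1]
  proof eventually_elim
    case (elim m)
    show ?case
    proof (intro allI impI)
      fix j assume win: "rejection_window A B \<beta> m j"
      note j = rejection_windowD[OF win \<open>A > 0\<close> \<open>1 \<le> m\<close>]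
      let ?y = "real m / (\<alpha> * real j)"
      have split: "real m powr \<beta> / (\<alpha> * d) = real m / (\<alpha> * (d * real m powr (1 - \<beta>)))" if "d > 0" for d
        using \<open>1 \<le> m\<close> by (simp add: powr_diff field_simps)
      have lo: "real m powr \<beta> / a1 \<le> ?y"
        unfolding a1_def split[OF A(2)] using j A \<open>1 \<le> m\<close> \<open>0 < \<alpha>\<close>
        by (intro divide_left_mono mult_left_mono mult_pos_pos) auto
      have hi: "?y \<le> real m powr \<beta> / a2"
        unfolding a2_def split[OF A(1)] using j A \<open>1 \<le> m\<close> \<open>0 < \<alpha>\<close>
        by (intro divide_left_mono mult_left_mono mult_pos_pos) auto
      have "1 \<le> ?y"
        using lo elim by linarith
      have nn: "0 \<le> log 2 (real m powr \<beta> / a1)"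
        using elim by simp
      have "log 2 (real m powr \<beta> / a1) \<le> log 2 ?y" "log 2 ?y \<le> log 2 (real m powr \<beta> / a2)"
        using lo hi elim \<open>1 \<le> ?y\<close> by (subst log_le_cancel_iff; linarith)+
      then have "ln (1 + log 2 (real m powr \<beta> / a1)) \<le> ln (1 + log 2 ?y)"
        "ln (1 + log 2 ?y) \<le> ln (1 + log 2 (real m powr \<beta> / a2))"
        using nn by auto
      then show "1 * ln (ln (real m)) \<le> Well_numerator \<delta> \<alpha> m j \<and> Well_numerator \<delta> \<alpha> m j \<le> 5 * ln (ln (real m))"
        using elim \<open>l > 0\<close> unfolding Well_numerator_def l_def[symmetric] by linarith
    qed
  qed
qed

text \<open>For \<open>\<beta> = 0\<close> the ratio \<open>m / (\<alpha> * j)\<close> stays between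
  1 and \<open>1 / (\<alpha> * A)\<close>, so the numerator lies between constants. The absolute
  value makes the upper constant visibly positive.\<close>

lemma Well_numerator_order_dense:
  assumes A: "A > 0" "B > 0" and \<alpha>: "0 < \<alpha>" "\<alpha> < 1" and \<delta>: "0 < \<delta>" "\<delta> < 1"
    and win: "rejection_window A B 0 m j" and "m \<ge> 1"
  shows "2 * ln ((pi\<^sup>2 / 6) / \<delta>) \<le> Well_numerator \<delta> \<alpha> m j"
    and "Well_numerator \<delta> \<alpha> m j \<le> 2 * ln ((pi\<^sup>2 / 6) / \<delta>) + 4 * \<bar>ln (1 + log 2 (1 / (\<alpha> * A)))\<bar>"
proof -
  note j = rejection_windowD[OF win \<open>A > 0\<close> \<open>m \<ge> 1\<close>]
  let ?y = "real m / (\<alpha> * real j)"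
  \<comment> \<open>The part \<open>j \<le> m\<close> of the window enters here: it makes the ratio
    at least 1 and its logarithm nonnegative.\<close>
  have "\<alpha> * real j \<le> 1 * real m"
    using j \<alpha> by (intro mult_mono) auto
  then have "1 \<le> ?y"
    using \<alpha> j by simp
  then have nn: "0 \<le> log 2 ?y"
    by simp
  then show "2 * ln ((pi\<^sup>2 / 6) / \<delta>) \<le> Well_numerator \<delta> \<alpha> m j"
    by (simp add: Well_numerator_def)
  have "?y \<le> real m / (\<alpha> * (A * real m))"
    using j A \<alpha> \<open>m \<ge> 1\<close> by (intro divide_left_mono mult_left_mono mult_pos_pos) auto
  also have "\<dots> = 1 / (\<alpha> * A)"
    using \<open>m \<ge> 1\<close> by simp
  finally have "log 2 ?y \<le> log 2 (1 / (\<alpha> * A))"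
    using \<open>1 \<le> ?y\<close> by (subst log_le_cancel_iff) (auto simp: A \<alpha>)
  then have "ln (1 + log 2 ?y) \<le> ln (1 + log 2 (1 / (\<alpha> * A)))"
    using nn by auto
  then show "Well_numerator \<delta> \<alpha> m j \<le> 2 * ln ((pi\<^sup>2 / 6) / \<delta>) + 4 * \<bar>ln (1 + log 2 (1 / (\<alpha> * A)))\<bar>"
    by (simp add: Well_numerator_def)
qed

text \<open>The rates are split by regime. The capped DKW excess never exceeds
  \<open>1 - \<alpha>\<close>, so for \<open>\<beta> > 1/2\<close>, where
  \<open>m powr (-1/2 + \<beta>)\<close> diverges, it has order 1 and the power rate belongs to the
  uncapped expression. For \<open>\<beta> = 0\<close> the ratio \<open>m / khat\<close> is bounded
  in probability, the iterated logarithm reduces to a constant, and the Wellner rate is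
  \<open>m powr (-1/2)\<close>.\<close>

theorem proposition13:
  fixes b c \<beta> \<delta> :: real
    and M :: "nat \<Rightarrow> 'a measure"
    and X :: "nat \<Rightarrow> nat \<Rightarrow> 'a \<Rightarrow> real"
    and H0 :: "nat \<Rightarrow> nat set"
    and khat :: "real \<Rightarrow> nat \<Rightarrow> 'a \<Rightarrow> nat"
  assumes "b > 0" and "0 < c" "c < 1" and "0 \<le> \<beta>" "\<beta> < 1" and "0 < \<delta>" "\<delta> < 1"
    and model: "\<And>m. m \<ge> 1 \<Longrightarrow> sparse_gaussian_model b c \<beta> m (M m) (X m) (H0 m)"
  defines "khat \<equiv> \<lambda>\<alpha> m \<omega>. BH_rejections m (\<lambda>i. Phi_bar (X m i \<omega>)) \<alpha>"
  shows "\<forall>\<alpha>\<in>{0<..<1}.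
     (\<beta> \<le> 1/2 \<longrightarrow>
        asymp_P M (\<lambda>m \<omega>. FDP_DKW \<delta> \<alpha> m (khat \<alpha> m \<omega>) - \<alpha>) (\<lambda>m _. real m powr (-1/2 + \<beta>))) \<and>
     (\<beta> > 1/2 \<longrightarrow>
        asymp_P M (\<lambda>m \<omega>. FDP_DKW \<delta> \<alpha> m (khat \<alpha> m \<omega>) - \<alpha>) (\<lambda>m _. 1) \<and>
        asymp_P M (\<lambda>m \<omega>. DKW_uncapped \<delta> \<alpha> m (khat \<alpha> m \<omega>) - \<alpha>) (\<lambda>m _. real m powr (-1/2 + \<beta>))) \<and>
     (\<beta> > 0 \<longrightarrow>
        asymp_P M (\<lambda>m \<omega>. FDP_Well \<delta> \<alpha> m (khat \<alpha> m \<omega>) - \<alpha>)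
          (\<lambda>m _. sqrt (ln (ln (real m))) * real m powr (-1/2 + \<beta>/2))) \<and>
     (\<beta> = 0 \<longrightarrow>
        asymp_P M (\<lambda>m \<omega>. FDP_Well \<delta> \<alpha> m (khat \<alpha> m \<omega>) - \<alpha>) (\<lambda>m _. real m powr (-1/2))) \<and>
     (\<beta> < 1/2 \<longrightarrow> BH_m_consistent M \<alpha> (\<lambda>m \<omega>. FDP_DKW \<delta> \<alpha> m (khat \<alpha> m \<omega>))) \<and>
     (\<beta> \<ge> 1/2 \<longrightarrow> \<not> BH_m_consistent M \<alpha> (\<lambda>m \<omega>. FDP_DKW \<delta> \<alpha> m (khat \<alpha> m \<omega>))) \<and>
     (\<beta> \<in> {0<..<1} \<longrightarrow> BH_m_consistent M \<alpha> (\<lambda>m \<omega>. FDP_Well \<delta> \<alpha> m (khat \<alpha> m \<omega>)))"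
proof
  fix \<alpha> :: real assume "\<alpha> \<in> {0<..<1}"
  then have \<alpha>: "0 < \<alpha>" "\<alpha> < 1" by auto
  let ?v = "\<lambda>m. real m powr (-1/2 + \<beta>)"
  obtain A B where A: "A > 0" "B > 0" and "whp M (khat \<alpha>) (rejection_window A B \<beta>)"
    using khat_order[OF assms(1-5) model \<alpha>] unfolding khat_def by blast
  note win = this(3)

  \<comment> \<open>The DKW bound, capped and uncapped\<close>
  define D where "D = sqrt (0.5 * ln (1 / \<delta>))"
  have "D > 0"
    using assms by (simp add: D_def)
  \<comment> \<open>One constant for both regimes: \<open>d * v\<close> lies below the cap when the
    rate \<open>v\<close> is at most 1, and \<open>d\<close> itself is a lower bound when
    \<open>v\<close> is at least 1.\<close>
  define d where "d = min (1 - \<alpha>) (D / B)"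
  have "d > 0"
    using \<alpha> A \<open>D > 0\<close> by (simp add: d_def)
  have DKW: "\<forall>\<^sub>F m in sequentially. \<forall>j. rejection_window A B \<beta> m j \<longrightarrow>
      D / B * ?v m \<le> DKW_uncapped \<delta> \<alpha> m j - \<alpha> \<and> DKW_uncapped \<delta> \<alpha> m j - \<alpha> \<le> D / A * ?v m"
    using eventually_ge_at_top[of 1]
    by eventually_elim (intro allI impI conjI DKW_uncapped_bounds[OF _ A _ assms(6,7) D_def])
  have DKW_capped: "\<forall>\<^sub>F m in sequentially. \<forall>j. rejection_window A B \<beta> m j \<longrightarrow>
      min (1 - \<alpha>) (D / B * ?v m) \<le> FDP_DKW \<delta> \<alpha> m j - \<alpha> \<and>
      FDP_DKW \<delta> \<alpha> m j - \<alpha> \<le> min (1 - \<alpha>) (D / A * ?v m)"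
    using DKW eventually_ge_at_top[of 1]
  proof eventually_elim
    case (elim m)
    show ?case
    proof (intro allI impI)
      fix j assume w: "rejection_window A B \<beta> m j"
      have "j \<ge> 1"
        by (rule rejection_windowD(1)[OF w A(1) elim(2)])
      show "min (1 - \<alpha>) (D / B * ?v m) \<le> FDP_DKW \<delta> \<alpha> m j - \<alpha> \<and>
          FDP_DKW \<delta> \<alpha> m j - \<alpha> \<le> min (1 - \<alpha>) (D / A * ?v m)"
        unfolding FDP_DKW_eq[OF \<open>j \<ge> 1\<close>] using elim(1) w by (intro conjI min.mono order_refl) auto
    qed
  qed
  have DKW_asymp: "asymp_P M (\<lambda>m \<omega>. FDP_DKW \<delta> \<alpha> m (khat \<alpha> m \<omega>) - \<alpha>) (\<lambda>m _. ?v m)" if "\<beta> \<le> 1/2"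
  proof (rule whp_imp_asymp_P[OF win \<open>d > 0\<close>, where ?c2.0 = "D / A"])
    show "\<forall>\<^sub>F m in sequentially. \<forall>j. rejection_window A B \<beta> m j \<longrightarrow>
        d * ?v m \<le> FDP_DKW \<delta> \<alpha> m j - \<alpha> \<and> FDP_DKW \<delta> \<alpha> m j - \<alpha> \<le> D / A * ?v m"
      using DKW_capped eventually_ge_at_top[of 1]
    proof eventually_elim
      case (elim m)
      have v1: "?v m \<le> 1"
        using powr_mono[of "-1/2 + \<beta>" 0 "real m"] elim that by simp
      have "d * ?v m \<le> d * 1" "d * ?v m \<le> D / B * ?v m"
        using v1 \<open>d > 0\<close> by (intro mult_left_mono mult_right_mono; simp add: d_def)+
      then have "d * ?v m \<le> min (1 - \<alpha>) (D / B * ?v m)"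
        by (simp add: d_def)
      then show ?case
        using elim(1) by fastforce
    qed
  qed (use A \<open>D > 0\<close> in auto)
  have DKW_ge: "\<forall>\<^sub>F m in sequentially. \<forall>j. rejection_window A B \<beta> m j \<longrightarrow> d \<le> FDP_DKW \<delta> \<alpha> m j - \<alpha>"
    if "\<beta> \<ge> 1/2"
    using DKW_capped eventually_ge_at_top[of 1]
  proof eventually_elim
    case (elim m)
    \<comment> \<open>The boundary \<open>\<beta> = 1/2\<close> is included: there the rate is
      constantly 1 and the excess does not vanish.\<close>
    have "1 \<le> ?v m"
      using powr_mono[of 0 "-1/2 + \<beta>" "real m"] elim that by simp
    then have "D / B * 1 \<le> D / B * ?v m"
      using \<open>D > 0\<close> A by (intro mult_left_mono) auto
    then have "d \<le> min (1 - \<alpha>) (D / B * ?v m)"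
      by (simp add: d_def min.coboundedI2)
    then show ?case
      using elim(1) by fastforce
  qed
  have DKW_asymp_1: "asymp_P M (\<lambda>m \<omega>. FDP_DKW \<delta> \<alpha> m (khat \<alpha> m \<omega>) - \<alpha>) (\<lambda>m _. 1)" if "\<beta> > 1/2"
  proof (rule whp_imp_asymp_P[OF win \<open>d > 0\<close>, where ?c2.0 = "1 - \<alpha>"])
    show "\<forall>\<^sub>F m in sequentially. \<forall>j. rejection_window A B \<beta> m j \<longrightarrow>
        d * 1 \<le> FDP_DKW \<delta> \<alpha> m j - \<alpha> \<and> FDP_DKW \<delta> \<alpha> m j - \<alpha> \<le> (1 - \<alpha>) * 1"
      using DKW_capped DKW_ge[OF less_imp_le[OF that]] by eventually_elim auto
  qed (use \<alpha> in auto)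
  have DKW_uncapped_asymp: "asymp_P M (\<lambda>m \<omega>. DKW_uncapped \<delta> \<alpha> m (khat \<alpha> m \<omega>) - \<alpha>) (\<lambda>m _. ?v m)"
    by (rule whp_imp_asymp_P[OF win _ _ DKW]) (use A \<open>D > 0\<close> in auto)
  have DKW_consistent: "BH_m_consistent M \<alpha> (\<lambda>m \<omega>. FDP_DKW \<delta> \<alpha> m (khat \<alpha> m \<omega>))" if "\<beta> < 1/2"
  proof (rule whp_imp_BH_m_consistent[OF win, where v = "\<lambda>m. D / A * ?v m"])
    show "\<forall>\<^sub>F m in sequentially. \<forall>j. rejection_window A B \<beta> m j \<longrightarrow> FDP_DKW \<delta> \<alpha> m j - \<alpha> \<le> D / A * ?v m"
      using DKW_capped by eventually_elim auto
    have "?v \<longlonglongrightarrow> 0"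
      using that by real_asymp
    then show "(\<lambda>m. D / A * ?v m) \<longlonglongrightarrow> 0"
      by (rule tendsto_mult_right_zero)
  qed
  have DKW_inconsistent: "\<not> BH_m_consistent M \<alpha> (\<lambda>m \<omega>. FDP_DKW \<delta> \<alpha> m (khat \<alpha> m \<omega>))" if "\<beta> \<ge> 1/2"
    by (rule whp_imp_not_BH_m_consistent[OF win \<open>d > 0\<close> DKW_ge[OF that]])

  \<comment> \<open>The Wellner bound for \<open>\<beta> > 0\<close>\<close>
  have Well_sparse:
    "asymp_P M (\<lambda>m \<omega>. FDP_Well \<delta> \<alpha> m (khat \<alpha> m \<omega>) - \<alpha>)
       (\<lambda>m _. sqrt (ln (ln (real m))) * real m powr (-1/2 + \<beta>/2))"
    "BH_m_consistent M \<alpha> (\<lambda>m \<omega>. FDP_Well \<delta> \<alpha> m (khat \<alpha> m \<omega>))" if "\<beta> > 0"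
  proof -
    let ?w = "\<lambda>m. sqrt (ln (ln (real m)) / real m powr (1 - \<beta>))"
    let ?c1 = "\<alpha> * sqrt (1 / (\<alpha> * B))" and ?c2 = "2 * \<alpha> * sqrt (5 / (\<alpha> * A))"
    have c: "?c1 > 0" "?c2 > 0"
      using \<alpha> A by auto
    \<comment> \<open>Proved for every \<open>m\<close>, as it rewrites under a lambda; at
      \<open>m = 0\<close> both sides are 0.\<close>
    have w_eq: "?w m = sqrt (ln (ln (real m))) * real m powr (-1/2 + \<beta>/2)" for m
    proof -
      have "sqrt (real m powr (1 - \<beta>)) = real m powr ((1 - \<beta>) * (1/2))"
        by (simp add: powr_half_sqrt[symmetric] powr_powr)
      also have "(1 - \<beta>) * (1/2) = - (-1/2 + \<beta>/2)"
        by (simp add: field_simps)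
      finally have "sqrt (real m powr (1 - \<beta>)) = inverse (real m powr (-1/2 + \<beta>/2))"
        by (simp only: powr_minus)
      then show ?thesis
        by (simp only: real_sqrt_divide) (simp only: divide_inverse inverse_inverse_eq)
    qed
    have lim: "(\<lambda>m. ln (ln (real m)) / real m powr (1 - \<beta>)) \<longlonglongrightarrow> 0"
      using \<open>\<beta> < 1\<close> by real_asymp
    have pos: "\<forall>\<^sub>F m in sequentially. 0 < ln (ln (real m))"
      by real_asymp
    note order = FDP_Well_order[OF A \<alpha> zero_less_one _ pos
        Well_numerator_order_sparse[OF A \<alpha>(1) that assms(6,7)] lim]
    have order': "\<forall>\<^sub>F m in sequentially. \<forall>j. rejection_window A B \<beta> m j \<longrightarrow>
        ?c1 * ?w m \<le> FDP_Well \<delta> \<alpha> m j - \<alpha> \<and> FDP_Well \<delta> \<alpha> m j - \<alpha> \<le> ?c2 * ?w m"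
      by (rule order) simp
    have "\<forall>\<^sub>F m in sequentially. 0 \<le> ?w m"
      using pos by eventually_elim simp
    from whp_imp_asymp_P[OF win c order' this]
    show "asymp_P M (\<lambda>m \<omega>. FDP_Well \<delta> \<alpha> m (khat \<alpha> m \<omega>) - \<alpha>)
       (\<lambda>m _. sqrt (ln (ln (real m))) * real m powr (-1/2 + \<beta>/2))"
      unfolding w_eq .
    show "BH_m_consistent M \<alpha> (\<lambda>m \<omega>. FDP_Well \<delta> \<alpha> m (khat \<alpha> m \<omega>))"
    proof (rule whp_imp_BH_m_consistent[OF win, where v = "\<lambda>m. ?c2 * ?w m"])
      show "\<forall>\<^sub>F m in sequentially. \<forall>j. rejection_window A B \<beta> m j \<longrightarrow> FDP_Well \<delta> \<alpha> m j - \<alpha> \<le> ?c2 * ?w m"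
        using order' by eventually_elim auto
      have "?w \<longlonglongrightarrow> sqrt 0"
        by (intro tendsto_intros lim)
      then show "(\<lambda>m. ?c2 * ?w m) \<longlonglongrightarrow> 0"
        by (intro tendsto_mult_right_zero) simp
    qed
  qed

  \<comment> \<open>The Wellner bound for \<open>\<beta> = 0\<close>\<close>
  have Well_dense: "asymp_P M (\<lambda>m \<omega>. FDP_Well \<delta> \<alpha> m (khat \<alpha> m \<omega>) - \<alpha>) (\<lambda>m _. real m powr (-1/2))"
    if "\<beta> = 0"
  proof -
    let ?w = "\<lambda>m. sqrt (1 / real m powr (1 - \<beta>))"
    define l1 where "l1 = 2 * ln ((pi\<^sup>2 / 6) / \<delta>)"
    define l2 where "l2 = l1 + 4 * \<bar>ln (1 + log 2 (1 / (\<alpha> * A)))\<bar>"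
    have l: "l1 > 0" "l2 > 0"
      using ln_kappa_over_delta_pos[OF assms(6,7)] by (auto simp: l1_def l2_def intro: add_pos_nonneg)
    let ?c1 = "\<alpha> * sqrt (l1 / (\<alpha> * B))" and ?c2 = "2 * \<alpha> * sqrt (l2 / (\<alpha> * A))"
    have c: "?c1 > 0" "?c2 > 0"
      using \<alpha> A l by auto
    have w_eq: "?w m = real m powr (-1/2)" for m
    proof -
      have "sqrt (real m) = real m powr (1/2)"
        by (simp add: powr_half_sqrt)
      then show ?thesis
        using that by (cases "m = 0") (simp_all add: real_sqrt_divide powr_minus_divide)
    qed
    have lim: "(\<lambda>m. 1 / real m powr (1 - \<beta>)) \<longlonglongrightarrow> 0"
      using \<open>\<beta> < 1\<close> by real_asymp
    have num: "\<forall>\<^sub>F m in sequentially. \<forall>j. rejection_window A B \<beta> m j \<longrightarrow>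
      l1 * 1 \<le> Well_numerator \<delta> \<alpha> m j \<and> Well_numerator \<delta> \<alpha> m j \<le> l2 * 1"
      using eventually_ge_at_top[of 1]
    proof eventually_elim
      case (elim m)
      then show ?case
        using Well_numerator_order_dense[OF A \<alpha> assms(6,7), of m] that by (simp add: l1_def l2_def)
    qed
    have order: "\<forall>\<^sub>F m in sequentially. \<forall>j. rejection_window A B \<beta> m j \<longrightarrow>
        ?c1 * ?w m \<le> FDP_Well \<delta> \<alpha> m j - \<alpha> \<and> FDP_Well \<delta> \<alpha> m j - \<alpha> \<le> ?c2 * ?w m"
      by (rule FDP_Well_order[OF A \<alpha> l _ num lim]) simp
    show ?thesis
      using whp_imp_asymp_P[OF win c order] unfolding w_eq by simp
  qed
  show "(\<beta> \<le> 1/2 \<longrightarrow>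
        asymp_P M (\<lambda>m \<omega>. FDP_DKW \<delta> \<alpha> m (khat \<alpha> m \<omega>) - \<alpha>) (\<lambda>m _. real m powr (-1/2 + \<beta>))) \<and>
     (\<beta> > 1/2 \<longrightarrow>
        asymp_P M (\<lambda>m \<omega>. FDP_DKW \<delta> \<alpha> m (khat \<alpha> m \<omega>) - \<alpha>) (\<lambda>m _. 1) \<and>
        asymp_P M (\<lambda>m \<omega>. DKW_uncapped \<delta> \<alpha> m (khat \<alpha> m \<omega>) - \<alpha>) (\<lambda>m _. real m powr (-1/2 + \<beta>))) \<and>
     (\<beta> > 0 \<longrightarrow>
        asymp_P M (\<lambda>m \<omega>. FDP_Well \<delta> \<alpha> m (khat \<alpha> m \<omega>) - \<alpha>)
          (\<lambda>m _. sqrt (ln (ln (real m))) * real m powr (-1/2 + \<beta>/2))) \<and>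
     (\<beta> = 0 \<longrightarrow>
        asymp_P M (\<lambda>m \<omega>. FDP_Well \<delta> \<alpha> m (khat \<alpha> m \<omega>) - \<alpha>) (\<lambda>m _. real m powr (-1/2))) \<and>
     (\<beta> < 1/2 \<longrightarrow> BH_m_consistent M \<alpha> (\<lambda>m \<omega>. FDP_DKW \<delta> \<alpha> m (khat \<alpha> m \<omega>))) \<and>
     (\<beta> \<ge> 1/2 \<longrightarrow> \<not> BH_m_consistent M \<alpha> (\<lambda>m \<omega>. FDP_DKW \<delta> \<alpha> m (khat \<alpha> m \<omega>))) \<and>
     (\<beta> \<in> {0<..<1} \<longrightarrow> BH_m_consistent M \<alpha> (\<lambda>m \<omega>. FDP_Well \<delta> \<alpha> m (khat \<alpha> m \<omega>)))"
    using DKW_asymp DKW_asymp_1 DKW_uncapped_asymp DKW_consistent DKW_inconsistent Well_sparse Well_dense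
    by (intro conjI impI) simp_all
qed

end
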